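(* Let $H\subset\mathbb{P}^2$ be a Herman ring with canonical parameter $t\in\mathbb{C}/\mathbb{Z}$, where $h_0<\Im(t)<h_1$. Then the function $\mathrm{Lyap}:(h_0,h_1)\to\mathbb{R}$ (the transverse Lyapunov exponent, as a function of $h=\Im(t)$) is convex and piecewise linear, with a jump in derivative at $h$ if and only if the transverse derivative $\partial U/\partial u$ has a zero on the circle $\Im(t)=h$. In fact the change in derivative at $h$ is equal to $2\pi$ times the number of zeros of $\partial U/\partial u$ on this circle, counted with multiplicity.
   Context: Here $\mathbb{P}^2=\mathbb{P}^2(\mathbb{C})$, and $H$ is an $f$-invariant Herman ring for a rational map $f$ of $\mathbb{P}^2$: a complex one-dimensional annulus smoothly embedded in $\mathbb{P}^2$ which $f$ maps to itself by an irrational rotation. A canonical parameter is a conformal embedding $t:H\to\mathbb{C}/\mathbb{Z}$ which maps $H$ isomorphically onto a cylinder of the form $h_0<\Im(t)<h_1$ in $\mathbb{C}/\mathbb{Z}$; it is unique up to a translation or change of sign $t\mapsto\pm t+\text{constant}$. For each invariant circle $\Im(t)=h$ in $H$, some neighborhood in $\mathbb{P}^2$ can be parametrized by holomorphic coordinates $(t,u)$, where $u$ ranges over a neighborhood of zero in $\mathbb{C}$ and $t$ over a neighborhood of the circle $\Im(t)=h$ in $\mathbb{C}/\mathbb{Z}$, such that $u=0$ on the part of $H$ in this neighborhood, with $t$ there the canonical parameter of $H$. In these coordinates $f$ has the form $(t,u)\mapsto(T,U)$, where $(t,0)$ maps to $(t+\alpha,0)$ for some irrational rotation number $\alpha$.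 The transverse derivative along $H$ is the partial derivative $\frac{\partial U}{\partial u}(t,0)$, and the transverse Lyapunov exponent is the horizontal average $$\mathrm{Lyap}(t)=\int_0^1\log\left|\frac{\partial U}{\partial u}(t+\tau,0)\right|d\tau,$$ which is constant on each invariant circle, so that it depends only on $\Im(t)$.
   Formalization: The formal statement additionally assumes that the transverse derivative is not identically zero on H; otherwise (for example a Herman ring inside an invariant critical line) Lyap is identically minus infinity and the claim fails. *)

theory Defs
  imports "HOL-Complex_Analysis.Complex_Analysis"
begin

section \<open>The complex projective plane\<close>

text \<open>Points are the lines through the origin in \<open>\<complex>\<^sup>3\<close>; the topology is the quotient topology.\<close>

typedef cp2 = "{l :: (complex^3) set. \<exists>v. v \<noteq> 0 \<and> l = range (\<lambda>c. c *s v)}"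
  morphisms line_of Abs_cp2
  by (rule exI[of _ "range (\<lambda>c. c *s (1 :: complex^3))"]) (auto intro!: exI[of _ 1])

definition proj :: "complex^3 \<Rightarrow> cp2"
  where "proj v = Abs_cp2 (range (\<lambda>c. c *s v))"  \<comment> \<open>unspecified for \<open>v = 0\<close>\<close>

definition cone :: "cp2 set \<Rightarrow> (complex^3) set"
  where "cone N = {v. v \<noteq> 0 \<and> proj v \<in> N}"

instantiation cp2 :: topological_space
begin

definition open_cp2 :: "cp2 set \<Rightarrow> bool"
  where "open_cp2 N \<longleftrightarrow> open (cone N)"

instance
proof
  have "cone UNIV = - {0}" by (auto simp: cone_def)
  then show "open (UNIV :: cp2 set)" by (simp add: open_cp2_def open_Compl)
next
  fix S T :: "cp2 set"
  assume "open S" "open T"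
  moreover have "cone (S \<inter> T) = cone S \<inter> cone T" by (auto simp: cone_def)
  ultimately show "open (S \<inter> T)" by (simp add: open_cp2_def open_Int)
next
  fix K :: "cp2 set set"
  assume "\<forall>S\<in>K. open S"
  moreover have "cone (\<Union>K) = (\<Union>S\<in>K. cone S)" by (auto simp: cone_def)
  ultimately show "open (\<Union>K)" by (auto simp: open_cp2_def)
qed

end


section \<open>Holomorphic functions of several variables, and maps to and from the plane\<close>

definition mholomorphic_on :: "(complex^'n \<Rightarrow> complex) \<Rightarrow> (complex^'n) set \<Rightarrow> bool"
    (infixl "mholomorphic'_on" 50)
  where "g mholomorphic_on S \<longleftrightarrow>
    open S \<and> (\<forall>v\<in>S. \<exists>a. (g has_derivative (\<lambda>w. \<Sum>i\<in>UNIV. a $ i * w $ i)) (at v))"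

definition holomorphic_into_cp2 :: "(complex^'n \<Rightarrow> cp2) \<Rightarrow> (complex^'n) set \<Rightarrow> bool"
  where "holomorphic_into_cp2 \<psi> S \<longleftrightarrow>
    open S \<and> (\<forall>p\<in>S. \<exists>V \<Phi>. open V \<and> p \<in> V \<and> V \<subseteq> S \<and>
      (\<forall>i. (\<lambda>q. \<Phi> q $ i) mholomorphic_on V) \<and>
      (\<forall>q\<in>V. \<Phi> q \<noteq> 0 \<and> \<psi> q = proj (\<Phi> q)))"

definition holomorphic_from_cp2 :: "(cp2 \<Rightarrow> complex) \<Rightarrow> cp2 set \<Rightarrow> bool"
  where "holomorphic_from_cp2 g N \<longleftrightarrow> open N \<and> (\<lambda>v. g (proj v)) mholomorphic_on cone N"


section \<open>Rational maps\<close>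

text \<open>Over \<open>\<complex>\<close> a homogeneous polynomial may be identified with the function it defines.
  The zero polynomial is homogeneous of every degree.\<close>

definition homogeneous_poly :: "nat \<Rightarrow> (complex^3 \<Rightarrow> complex) \<Rightarrow> bool"
  where "homogeneous_poly d P \<longleftrightarrow> (\<exists>c. \<forall>v.
    P v = (\<Sum>i\<le>d. \<Sum>j\<le>d-i. c i j * (v$1)^i * (v$2)^j * (v$3)^(d-i-j)))"

text \<open>A rational map is given by three homogeneous polynomials of the same degree, not all zero
  and without nonconstant common factor (factors of homogeneous polynomials are homogeneous).
  Its points of indeterminacy are then exactly the common zeros.\<close>

definition rational_map :: "(complex^3 \<Rightarrow> complex^3) \<Rightarrow> bool"
  where "rational_map F \<longleftrightarrow> (\<exists>v. F v \<noteq> 0) \<and>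
    (\<exists>d. (\<forall>i. homogeneous_poly d (\<lambda>v. F v $ i)) \<and>
      \<not> (\<exists>e G Q. 1 \<le> e \<and> e \<le> d \<and> homogeneous_poly e G \<and>
            (\<forall>i. homogeneous_poly (d - e) (Q i)) \<and> (\<forall>v i. F v $ i = G v * Q i v)))"

definition indeterminacy :: "(complex^3 \<Rightarrow> complex^3) \<Rightarrow> cp2 set"
  where "indeterminacy F = {proj v |v. v \<noteq> 0 \<and> F v = 0}"

definition rat_map :: "(complex^3 \<Rightarrow> complex^3) \<Rightarrow> cp2 \<Rightarrow> cp2"
  where "rat_map F p = proj (F (SOME v. v \<noteq> 0 \<and> proj v = p))"
    \<comment> \<open>meaningful outside \<open>indeterminacy F\<close>\<close>


section \<open>Herman rings and adapted coordinates\<close>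

text \<open>Subsets of \<open>\<complex>/\<int>\<close> are represented by subsets of \<open>\<complex>\<close> invariant under \<open>t \<mapsto> t + 1\<close>, and maps
  defined on them by maps that are \<open>1\<close>-periodic in \<open>t\<close>. The ends \<open>h0\<close>, \<open>h1\<close> of the cylinder
  are allowed to be infinite.\<close>

definition heights :: "ereal \<Rightarrow> ereal \<Rightarrow> real set"
  where "heights h0 h1 = {h. h0 < ereal h \<and> ereal h < h1}"

definition cylinder :: "ereal \<Rightarrow> ereal \<Rightarrow> complex set"
  where "cylinder h0 h1 = {t. Im t \<in> heights h0 h1}"

text \<open>The map \<open>\<iota>\<close> is the inverse of a canonical parameter: a holomorphic embedding (injective
  immersion and homeomorphism onto its image) of the cylinder modulo \<open>\<int>\<close>. In terms of a local
  lift \<open>\<Phi>\<close> to \<open>\<complex>\<^sup>3\<close>, immersion means that \<open>\<Phi>'(t)\<close> is not a multiple of \<open>\<Phi>(t)\<close>.\<close>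

definition embedded_annulus :: "ereal \<Rightarrow> ereal \<Rightarrow> (complex \<Rightarrow> cp2) \<Rightarrow> bool"
  where "embedded_annulus h0 h1 \<iota> \<longleftrightarrow> h0 < h1 \<and>
    (\<forall>s\<in>cylinder h0 h1. \<forall>t\<in>cylinder h0 h1. \<iota> s = \<iota> t \<longleftrightarrow> s - t \<in> \<int>) \<and>
    (\<forall>t\<in>cylinder h0 h1. \<exists>V \<Phi>. open V \<and> t \<in> V \<and> V \<subseteq> cylinder h0 h1 \<and>
        (\<forall>i. (\<lambda>s. \<Phi> s $ i) holomorphic_on V) \<and>
        (\<forall>s\<in>V. \<Phi> s \<noteq> 0 \<and> \<iota> s = proj (\<Phi> s)) \<and>
        (\<forall>c. (\<chi> i. deriv (\<lambda>s. \<Phi> s $ i) t) \<noteq> c *s \<Phi> t)) \<and>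
    (\<forall>V. open V \<and> V \<subseteq> cylinder h0 h1 \<longrightarrow>
        openin (top_of_set (\<iota> ` cylinder h0 h1)) (\<iota> ` V))"

text \<open>The Herman ring is the set \<open>H = \<iota> ` cylinder h0 h1\<close>.\<close>

definition herman_ring ::
    "(complex^3 \<Rightarrow> complex^3) \<Rightarrow> cp2 set \<Rightarrow> ereal \<Rightarrow> ereal \<Rightarrow> (complex \<Rightarrow> cp2) \<Rightarrow> real \<Rightarrow> bool"
  where "herman_ring F H h0 h1 \<iota> \<alpha> \<longleftrightarrow>
    embedded_annulus h0 h1 \<iota> \<and> H = \<iota> ` cylinder h0 h1 \<and>
    H \<inter> indeterminacy F = {} \<and> \<alpha> \<notin> \<rat> \<and>
    (\<forall>t\<in>cylinder h0 h1. rat_map F (\<iota> t) = \<iota> (t + of_real \<alpha>))"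

text \<open>Holomorphic coordinates \<open>(t,u)\<close> on a neighborhood of the circle \<open>Im t = h\<close>, given by a
  biholomorphic parametrization \<open>\<psi>\<close>, defined for \<open>t \<in> A\<close> modulo \<open>\<int>\<close> and \<open>u \<in> B\<close>, such that
  \<open>u = 0\<close> on the part of the ring in this neighborhood, with \<open>t\<close> there the canonical parameter.
  The third-to-last clause says that \<open>\<psi>\<close> has holomorphic local inverses on open sets.\<close>

definition adapted_coordinates ::
    "ereal \<Rightarrow> ereal \<Rightarrow> (complex \<Rightarrow> cp2) \<Rightarrow> real \<Rightarrow>
     complex set \<Rightarrow> complex set \<Rightarrow> (complex \<Rightarrow> complex \<Rightarrow> cp2) \<Rightarrow> bool"
  where "adapted_coordinates h0 h1 \<iota> h A B \<psi> \<longleftrightarrow>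
    open A \<and> (\<forall>t. t \<in> A \<longleftrightarrow> t + 1 \<in> A) \<and> {t. Im t = h} \<subseteq> A \<and> open B \<and> 0 \<in> B \<and>
    (\<forall>t\<in>A. \<forall>t'\<in>A. \<forall>u\<in>B. \<forall>u'\<in>B. \<psi> t u = \<psi> t' u' \<longleftrightarrow> t - t' \<in> \<int> \<and> u = u') \<and>
    holomorphic_into_cp2 (\<lambda>p :: complex^2. \<psi> (p$1) (p$2)) {p. p$1 \<in> A \<and> p$2 \<in> B} \<and>
    (\<forall>t\<in>A. \<forall>u\<in>B. \<exists>N \<tau> \<mu>. \<psi> t u \<in> N \<and>
        holomorphic_from_cp2 \<tau> N \<and> holomorphic_from_cp2 \<mu> N \<and>
        (\<forall>p\<in>N. \<tau> p \<in> A \<and> \<mu> p \<in> B \<and> \<psi> (\<tau> p) (\<mu> p) = p)) \<and>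
    (\<forall>t. Im t = h \<longrightarrow> (\<exists>t'\<in>A. \<exists>u\<in>B. \<iota> t = \<psi> t' u)) \<and>
    (\<forall>t\<in>A. \<forall>u\<in>B. \<forall>s\<in>cylinder h0 h1. \<psi> t u = \<iota> s \<longrightarrow> u = 0 \<and> t - s \<in> \<int>)"


section \<open>Transverse derivative and transverse Lyapunov exponent\<close>

definition u_coord ::
    "complex set \<Rightarrow> complex set \<Rightarrow> (complex \<Rightarrow> complex \<Rightarrow> cp2) \<Rightarrow> cp2 \<Rightarrow> complex"
  where "u_coord A B \<psi> p = (THE u. u \<in> B \<and> (\<exists>t\<in>A. \<psi> t u = p))"

text \<open>The derivative \<open>\<partial>U/\<partial>u (t,0)\<close>, where \<open>(t,u) \<mapsto> (T,U)\<close> is the map in the given coordinates.\<close>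

definition transverse_deriv ::
    "(complex^3 \<Rightarrow> complex^3) \<Rightarrow> complex set \<Rightarrow> complex set \<Rightarrow> (complex \<Rightarrow> complex \<Rightarrow> cp2) \<Rightarrow>
     complex \<Rightarrow> complex"
  where "transverse_deriv F A B \<psi> t = deriv (\<lambda>u. u_coord A B \<psi> (rat_map F (\<psi> t u))) 0"

definition horizontal_log_average :: "(complex \<Rightarrow> complex) \<Rightarrow> complex \<Rightarrow> real"
  where "horizontal_log_average D t = (LINT \<tau>:{0..1}|lborel. ln (cmod (D (t + of_real \<tau>))))"

text \<open>One representative modulo \<open>\<int>\<close> for each zero on the circle.\<close>

definition circle_zeros :: "(complex \<Rightarrow> complex) \<Rightarrow> real \<Rightarrow> complex set"
  where "circle_zeros D h = {t. Im t = h \<and> 0 \<le> Re t \<and> Re t < 1 \<and> D t = 0}"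

definition piecewise_linear_on :: "real set \<Rightarrow> (real \<Rightarrow> real) \<Rightarrow> bool"
  where "piecewise_linear_on I L \<longleftrightarrow> (\<exists>K\<subseteq>I.
    (\<forall>a b. {a..b} \<subseteq> I \<longrightarrow> finite (K \<inter> {a..b})) \<and>
    (\<forall>a b. {a..b} \<subseteq> I \<and> {a<..<b} \<inter> K = {} \<longrightarrow> (\<exists>m c. \<forall>x\<in>{a..b}. L x = m * x + c)))"
  \<comment> \<open>On an open interval the breakpoints \<open>K\<close> may accumulate only at the ends.\<close>

end

theory Submission
  imports Defs
begin

text \<open>In one system of adapted coordinates the transverse derivative \<open>D t\<close> is a \<open>1\<close>-periodic
  holomorphic function on a strip around the circle \<open>Im t = h\<close>, and the statement near \<open>h\<close> is
  Jensen's formula. If \<open>a\<close> runs over the zeros of \<open>D\<close> on the circle, with multiplicities \<open>m a\<close>, then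
  on a thin strip \<open>D t = g t * (\<Prod>a. (exp (2\<pi>\<i>t) - exp (2\<pi>\<i>a)) ^ m a)\<close> with \<open>g\<close> periodic and without
  zeros (\<open>periodic_factorization\<close>). The mean of \<open>ln |g|\<close> over a period is an affine function of the
  height (\<open>mean_ln_nonvanishing\<close>), and the mean of \<open>ln |exp (2\<pi>\<i>t) - exp (2\<pi>\<i>a)|\<close> at height \<open>y\<close> is
  \<open>- 2\<pi>y + 2\<pi> max 0 (y - h)\<close> (\<open>has_mean_ln_e1_diff\<close>). So near \<open>h\<close> the mean of \<open>ln |D|\<close> is affine up to
  one kink at \<open>h\<close>, where the slope jumps by \<open>2\<pi>\<close> times the number of zeros (\<open>mean_ln_local_form\<close>).

  The Lyapunov exponent at each height is computed in a coordinate system of its own. Two systems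
  differ along the ring by a periodic holomorphic factor \<open>c\<close> without zeros, and since the map rotates
  the ring by \<open>\<alpha>\<close>, the two transverse derivatives differ by the factor \<open>c (t + \<alpha>) / c t\<close>
  (\<open>transition\<close>). This does not change zeros, and its logarithm has mean zero because a rotation
  preserves the mean (\<open>mean_coord_deriv_eq\<close>). Hence near \<open>h\<close> the exponent is the logarithmic mean of
  the single function \<open>D h\<close>, which is not identically zero: the heights where it is form an open and
  closed set (\<open>D_nonzero\<close>), which is not everything by assumption.

  It remains to pass from the local form to the whole interval. A function which near every point
  is affine up to a kink with nonnegative jump lies below its chords (\<open>kinks_below_chord\<close>), hence is
  convex; where there is no kink this applies to the function and to its negative, so that it is
  affine.\<close>

unbundle no Formal_Power_Series.fps_syntax

section \<open>Points of the projective plane\<close>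

lemma line_of_proj:
  assumes "v \<noteq> 0"
  shows "line_of (proj v) = range (\<lambda>c. c *s v)"
  unfolding proj_def using assms by (subst Abs_cp2_inverse) auto

lemma proj_eq_iff:
  assumes "v \<noteq> 0" "w \<noteq> 0"
  shows "proj v = proj w \<longleftrightarrow> (\<exists>c. c \<noteq> 0 \<and> w = c *s v)"
proof
  assume "proj v = proj w"
  hence "range (\<lambda>c. c *s v) = range (\<lambda>c. c *s w)"
    using line_of_proj assms by metis
  moreover have "w \<in> range (\<lambda>c. c *s w)" by (rule range_eqI[of _ _ 1]) simp
  ultimately obtain c where "w = c *s v" by auto
  with \<open>w \<noteq> 0\<close> show "\<exists>c. c \<noteq> 0 \<and> w = c *s v" by (intro exI[of _ c]) auto
next
  assume "\<exists>c. c \<noteq> 0 \<and> w = c *s v"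
  then obtain c where c: "c \<noteq> 0" "w = c *s v" by auto
  have "range (\<lambda>d. d *s v) = range (\<lambda>d. d *s w)"
  proof (intro equalityI image_subsetI)
    fix d show "d *s v \<in> range (\<lambda>d. d *s w)"
      by (rule range_eqI[of _ _ "d / c"]) (use c in \<open>simp add: vector_smult_assoc\<close>)
  next
    fix d show "d *s w \<in> range (\<lambda>d. d *s v)"
      by (rule range_eqI[of _ _ "d * c"]) (use c in \<open>simp add: vector_smult_assoc\<close>)
  qed
  thus "proj v = proj w" by (simp add: proj_def)
qed

section \<open>Holomorphic functions of several variables\<close>

lemma mholomorphic_onD:
  assumes "g mholomorphic_on S" "v \<in> S"
  obtains a where "(g has_derivative (\<lambda>w. \<Sum>i\<in>UNIV. a $ i * w $ i)) (at v)"
  using assms by (auto simp: mholomorphic_on_def)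

lemma mholomorphic_on_subset:
  "g mholomorphic_on S \<Longrightarrow> open T \<Longrightarrow> T \<subseteq> S \<Longrightarrow> g mholomorphic_on T"
  by (auto simp: mholomorphic_on_def)

lemma mholomorphic_on_imp_continuous_on:
  "g mholomorphic_on S \<Longrightarrow> continuous_on S g"
  by (intro continuous_at_imp_continuous_on ballI)
     (auto simp: mholomorphic_on_def intro: has_derivative_continuous)

lemma mholomorphic_on_const: "open S \<Longrightarrow> (\<lambda>_. c) mholomorphic_on S"
  unfolding mholomorphic_on_def
  by (intro conjI ballI exI[of _ 0]) (auto intro!: derivative_eq_intros)

lemma mholomorphic_on_component: "open S \<Longrightarrow> (\<lambda>v. v $ i) mholomorphic_on S"
  unfolding mholomorphic_on_def
proof (intro conjI ballI exI[of _ "axis i 1"])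
  fix v :: "complex^'a" assume "open S"
  have "((\<lambda>v. v $ i) has_derivative (\<lambda>w. w $ i)) (at v)"
    by (rule bounded_linear_imp_has_derivative) (rule bounded_linear_vec_nth)
  moreover have "(\<lambda>w. w $ i) = (\<lambda>w. \<Sum>j\<in>UNIV. axis i 1 $ j * w $ j :: complex)"
    by (auto simp: axis_def if_distrib[of "\<lambda>x. x * _"] fun_eq_iff cong: if_cong)
  ultimately show "((\<lambda>v. v $ i) has_derivative (\<lambda>w. \<Sum>j\<in>UNIV. axis i 1 $ j * w $ j :: complex)) (at v)"
    by simp
qed

lemma mholomorphic_on_add:
  assumes "f mholomorphic_on S" "g mholomorphic_on S"
  shows "(\<lambda>v. f v + g v) mholomorphic_on S"
  unfolding mholomorphic_on_def
proof (intro conjI ballI)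
  show "open S" using assms by (simp add: mholomorphic_on_def)
  fix v assume v: "v \<in> S"
  obtain a where a: "(f has_derivative (\<lambda>w. \<Sum>i\<in>UNIV. a $ i * w $ i)) (at v)"
    using mholomorphic_onD[OF assms(1) v] .
  obtain b where b: "(g has_derivative (\<lambda>w. \<Sum>i\<in>UNIV. b $ i * w $ i)) (at v)"
    using mholomorphic_onD[OF assms(2) v] .
  show "\<exists>a. ((\<lambda>v. f v + g v) has_derivative (\<lambda>w. \<Sum>i\<in>UNIV. a $ i * w $ i)) (at v)"
    by (rule exI[of _ "a + b"], rule has_derivative_eq_rhs, rule has_derivative_add[OF a b])
       (simp add: fun_eq_iff sum.distrib algebra_simps)
qed

lemma mholomorphic_on_mult:
  assumes "f mholomorphic_on S" "g mholomorphic_on S"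
  shows "(\<lambda>v. f v * g v) mholomorphic_on S"
  unfolding mholomorphic_on_def
proof (intro conjI ballI)
  show "open S" using assms by (simp add: mholomorphic_on_def)
  fix v assume v: "v \<in> S"
  obtain a where a: "(f has_derivative (\<lambda>w. \<Sum>i\<in>UNIV. a $ i * w $ i)) (at v)"
    using mholomorphic_onD[OF assms(1) v] .
  obtain b where b: "(g has_derivative (\<lambda>w. \<Sum>i\<in>UNIV. b $ i * w $ i)) (at v)"
    using mholomorphic_onD[OF assms(2) v] .
  show "\<exists>a. ((\<lambda>v. f v * g v) has_derivative (\<lambda>w. \<Sum>i\<in>UNIV. a $ i * w $ i)) (at v)"
    by (rule exI[of _ "f v *s b + g v *s a"], rule has_derivative_eq_rhs, rule has_derivative_mult[OF a b])
       (simp add: fun_eq_iff sum.distrib algebra_simps sum_distrib_left)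
qed

lemma mholomorphic_on_sum:
  assumes "open S" "\<And>k. k \<in> K \<Longrightarrow> f k mholomorphic_on S"
  shows "(\<lambda>v. \<Sum>k\<in>K. f k v) mholomorphic_on S"
  using assms(2) by (induction K rule: infinite_finite_induct)
    (auto intro: mholomorphic_on_add mholomorphic_on_const assms(1))

lemma mholomorphic_on_power: "f mholomorphic_on S \<Longrightarrow> (\<lambda>v. f v ^ n) mholomorphic_on S"
proof (induction n)
  case 0
  thus ?case using mholomorphic_on_const[of S 1] by (simp add: mholomorphic_on_def)
next
  case (Suc n)
  thus ?case using mholomorphic_on_mult[of f S "\<lambda>v. f v ^ n"] by simp
qed

lemma has_derivative_componentwise_cvec:
  fixes \<Phi> :: "'a::real_normed_vector \<Rightarrow> complex^'n"
  assumes "\<And>i. ((\<lambda>q. \<Phi> q $ i) has_derivative (\<lambda>w. L w $ i)) (at p)"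
  shows "(\<Phi> has_derivative L) (at p)"
proof -
  have "((\<lambda>q. \<Sum>i\<in>UNIV. axis i (\<Phi> q $ i)) has_derivative (\<lambda>w. \<Sum>i\<in>UNIV. axis i (L w $ i))) (at p)"
  proof (rule has_derivative_sum)
    fix i :: 'n
    have "bounded_linear (\<lambda>z. axis i z :: complex^'n)"
    proof (rule linear_conv_bounded_linear[THEN iffD1], rule linearI)
      show "axis i (x + y) = (axis i x + axis i y :: complex^'n)" for x y by (simp add: vec_eq_iff axis_def)
      show "axis i (r *\<^sub>R x) = (r *\<^sub>R axis i x :: complex^'n)" for x r by (simp add: vec_eq_iff axis_def)
    qed
    from bounded_linear.has_derivative[OF this assms]
    show "((\<lambda>q. axis i (\<Phi> q $ i) :: complex^'n) has_derivative (\<lambda>w. axis i (L w $ i))) (at p)" .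
  qed
  moreover have "(\<Sum>i\<in>UNIV. axis i (v $ i)) = v" for v :: "complex^'n"
    by (simp add: vec_eq_iff axis_def)
  ultimately show ?thesis by simp
qed

lemma mholomorphic_on_vec_has_derivative:
  fixes \<Phi> :: "complex^'m \<Rightarrow> complex^'n"
  assumes "\<And>i. (\<lambda>q. \<Phi> q $ i) mholomorphic_on V" "p \<in> V"
  obtains b where "(\<Phi> has_derivative (\<lambda>w. \<chi> i. \<Sum>j\<in>UNIV. b i $ j * w $ j)) (at p)"
proof -
  have "\<forall>i. \<exists>a. ((\<lambda>q. \<Phi> q $ i) has_derivative (\<lambda>w. \<Sum>j\<in>UNIV. a $ j * w $ j)) (at p)"
    using assms by (auto simp: mholomorphic_on_def)
  then obtain b where b: "\<And>i. ((\<lambda>q. \<Phi> q $ i) has_derivative (\<lambda>w. \<Sum>j\<in>UNIV. b i $ j * w $ j)) (at p)"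
    by metis
  show ?thesis
    by (rule that[of b], rule has_derivative_componentwise_cvec) (use b in simp)
qed

lemma mholomorphic_on_vec_continuous_on:
  fixes \<Phi> :: "complex^'m \<Rightarrow> complex^'n"
  assumes "\<And>i. (\<lambda>q. \<Phi> q $ i) mholomorphic_on V"
  shows "continuous_on V \<Phi>"
proof (intro continuous_at_imp_continuous_on ballI)
  fix p assume "p \<in> V"
  then obtain b where "(\<Phi> has_derivative (\<lambda>w. \<chi> i. \<Sum>j\<in>UNIV. b i $ j * w $ j)) (at p)"
    using mholomorphic_on_vec_has_derivative[OF assms] by blast
  thus "isCont \<Phi> p" by (rule has_derivative_continuous)
qed

lemma mholomorphic_on_compose:
  fixes \<Phi> :: "complex^'m \<Rightarrow> complex^'n"
  assumes "\<And>i. (\<lambda>q. \<Phi> q $ i) mholomorphic_on V" "g mholomorphic_on W" "\<Phi> ` V \<subseteq> W"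
  shows "(\<lambda>q. g (\<Phi> q)) mholomorphic_on V"
  unfolding mholomorphic_on_def
proof (intro conjI ballI)
  show "open V" using assms(1) by (simp add: mholomorphic_on_def)
  fix p assume p: "p \<in> V"
  obtain b where b: "(\<Phi> has_derivative (\<lambda>w. \<chi> i. \<Sum>j\<in>UNIV. b i $ j * w $ j)) (at p)"
    using mholomorphic_on_vec_has_derivative[OF assms(1) p] .
  obtain a where a: "(g has_derivative (\<lambda>w. \<Sum>i\<in>UNIV. a $ i * w $ i)) (at (\<Phi> p))"
    using mholomorphic_onD[OF assms(2)] p assms(3) by blast
  show "\<exists>a. ((\<lambda>q. g (\<Phi> q)) has_derivative (\<lambda>w. \<Sum>i\<in>UNIV. a $ i * w $ i)) (at p)"
  proof (rule exI[of _ "\<chi> j. \<Sum>i\<in>UNIV. a $ i * b i $ j"], rule has_derivative_eq_rhs,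
         rule has_derivative_compose[OF b a])
    have "(\<Sum>i\<in>UNIV. \<Sum>j\<in>UNIV. a $ i * (b i $ j * x $ j)) =
          (\<Sum>j\<in>UNIV. \<Sum>i\<in>UNIV. a $ i * b i $ j * x $ j)" for x
      by (subst sum.swap) (simp add: mult.assoc)
    thus "(\<lambda>x. \<Sum>i\<in>UNIV. a $ i * (\<chi> i. \<Sum>j\<in>UNIV. b i $ j * x $ j) $ i) =
          (\<lambda>w. \<Sum>j\<in>UNIV. (\<chi> j. \<Sum>i\<in>UNIV. a $ i * b i $ j) $ j * w $ j)"
      by (simp add: fun_eq_iff sum_distrib_left sum_distrib_right)
  qed
qed

section \<open>Homogeneous polynomials and rational maps\<close>

lemma homogeneous_poly_scale:
  assumes "homogeneous_poly d P"
  shows "P (c *s v) = c ^ d * P v"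
proof -
  obtain k where k: "\<And>v. P v = (\<Sum>i\<le>d. \<Sum>j\<le>d-i. k i j * (v$1)^i * (v$2)^j * (v$3)^(d-i-j))"
    using assms by (auto simp: homogeneous_poly_def)
  have "k i j * (c * v$1)^i * (c * v$2)^j * (c * v$3)^(d-i-j)
      = c ^ d * (k i j * (v$1)^i * (v$2)^j * (v$3)^(d-i-j))" if "i \<le> d" "j \<le> d - i" for i j
  proof -
    have "c ^ d = c ^ i * c ^ j * c ^ (d - i - j)"
      using that by (simp flip: power_add)
    thus ?thesis by (simp add: power_mult_distrib mult_ac)
  qed
  hence "(\<Sum>i\<le>d. \<Sum>j\<le>d-i. k i j * (c * v$1)^i * (c * v$2)^j * (c * v$3)^(d-i-j))
      = (\<Sum>i\<le>d. \<Sum>j\<le>d-i. c ^ d * (k i j * (v$1)^i * (v$2)^j * (v$3)^(d-i-j)))"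
    by (intro sum.cong) auto
  thus ?thesis by (simp only: k sum_distrib_left vector_smult_component)
qed

lemma homogeneous_poly_mholomorphic:
  assumes "homogeneous_poly d P"
  shows "P mholomorphic_on UNIV"
proof -
  obtain k where "P = (\<lambda>v. \<Sum>i\<le>d. \<Sum>j\<le>d-i. k i j * (v$1)^i * (v$2)^j * (v$3)^(d-i-j))"
    using assms by (auto simp: homogeneous_poly_def fun_eq_iff)
  thus ?thesis
    by (auto intro!: mholomorphic_on_sum mholomorphic_on_mult mholomorphic_on_power
        mholomorphic_on_const mholomorphic_on_component)
qed

lemma rat_map_proj:
  assumes "rational_map F" "v \<noteq> 0"
  shows "rat_map F (proj v) = proj (F v)"
proof -
  obtain d where d: "\<And>i. homogeneous_poly d (\<lambda>v. F v $ i)"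
    using assms by (auto simp: rational_map_def)
  define w where "w = (SOME w. w \<noteq> 0 \<and> proj w = proj v)"
  have w: "w \<noteq> 0 \<and> proj w = proj v"
    unfolding w_def by (rule someI[of _ v]) (use assms in simp)
  then obtain c where c: "c \<noteq> 0" "v = c *s w"
    using proj_eq_iff assms(2) by blast
  have Fv: "F v = c ^ d *s F w"
    unfolding c(2) using homogeneous_poly_scale[OF d] by (simp add: vec_eq_iff)
  have "proj (F w) = proj (F v)"
  proof (cases "F w = 0")
    case True thus ?thesis by (simp add: Fv)
  next
    case False
    moreover have "F v \<noteq> 0" using False c(1) by (simp add: Fv)
    ultimately show ?thesis using c(1) by (subst proj_eq_iff) (auto simp: Fv intro!: exI[of _ "c^d"])
  qed
  thus ?thesis by (simp add: rat_map_def flip: w_def)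
qed

section \<open>Partial derivatives of holomorphic functions of two variables\<close>

abbreviation pt :: "complex \<Rightarrow> complex \<Rightarrow> complex^2"
  where "pt t u \<equiv> vector [t, u]"

lemma mholomorphic_on_curve_has_field_derivative:
  fixes Q :: "complex^2 \<Rightarrow> complex"
  assumes Q: "(Q has_derivative (\<lambda>w. \<Sum>i\<in>UNIV. a $ i * w $ i)) (at (pt (s x) (w x)))"
    and s: "(s has_field_derivative s') (at x)" and w: "(w has_field_derivative w') (at x)"
  shows "((\<lambda>x. Q (pt (s x) (w x))) has_field_derivative a $ 1 * s' + a $ 2 * w') (at x)"
proof -
  have "((\<lambda>x. pt (s x) (w x)) has_derivative (\<lambda>y. pt (s' * y) (w' * y))) (at x)"
  proof (rule has_derivative_componentwise_cvec)
    fix i :: 2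
    show "((\<lambda>q. pt (s q) (w q) $ i) has_derivative (\<lambda>y. pt (s' * y) (w' * y) $ i)) (at x)"
      using exhaust_2[of i] s w by (auto simp: has_field_derivative_def)
  qed
  from has_derivative_compose[OF this Q] show ?thesis
    unfolding has_field_derivative_def
    by (rule has_derivative_eq_rhs) (simp add: fun_eq_iff sum_2 algebra_simps)
qed

lemma
  fixes Q :: "complex^2 \<Rightarrow> complex"
  assumes "Q mholomorphic_on V" "pt t u \<in> V"
  shows mholomorphic_on_slice1: "(\<lambda>s. Q (pt s u)) field_differentiable at t"
    and mholomorphic_on_slice2: "(\<lambda>v. Q (pt t v)) field_differentiable at u"
proof -
  obtain a where a: "(Q has_derivative (\<lambda>w. \<Sum>i\<in>UNIV. a $ i * w $ i)) (at (pt t u))"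
    using mholomorphic_onD[OF assms] .
  show "(\<lambda>s. Q (pt s u)) field_differentiable at t"
    using mholomorphic_on_curve_has_field_derivative[of Q a "\<lambda>s. s" t "\<lambda>_. u" 1 0] a
    by (auto simp: field_differentiable_def)
  show "(\<lambda>v. Q (pt t v)) field_differentiable at u"
    using mholomorphic_on_curve_has_field_derivative[of Q a "\<lambda>_. t" u "\<lambda>v. v" 0 1] a
    by (auto simp: field_differentiable_def)
qed

lemma continuous_on_pt: "continuous_on S (\<lambda>z. pt (fst z) (snd z))"
proof -
  have "continuous_on S (\<lambda>z. \<chi> i::2. if i = 1 then fst z else snd z)"
  proof (rule continuous_on_vec_lambda)
    fix i :: 2
    show "continuous_on S (\<lambda>z. if i = 1 then fst z else snd z)"
      by (cases "i = 1") (auto intro!: continuous_intros)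
  qed
  also have "(\<lambda>z. \<chi> i::2. if i = 1 then fst z else snd z) = (\<lambda>z. pt (fst z) (snd z) :: complex^2)"
    by (auto simp: fun_eq_iff vec_eq_iff forall_2)
  finally show ?thesis .
qed

lemma open_pt_vimage:
  assumes "open V"
  shows "open {z. pt (fst z) (snd z) \<in> V}"
  using open_vimage[OF assms continuous_on_pt] by (simp add: vimage_def)

lemma open_pt_slices:
  assumes "open V"
  shows "open {t. pt t u \<in> V}" "open {u. pt t u \<in> V}"
proof -
  have "open ((\<lambda>t. (t, u)) -` {z. pt (fst z) (snd z) \<in> V})"
    by (rule open_vimage[OF open_pt_vimage[OF assms]]) (auto intro!: continuous_intros)
  thus "open {t. pt t u \<in> V}" by (simp add: vimage_def)
  have "open ((\<lambda>u. (t, u)) -` {z. pt (fst z) (snd z) \<in> V})"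
    by (rule open_vimage[OF open_pt_vimage[OF assms]]) (auto intro!: continuous_intros)
  thus "open {u. pt t u \<in> V}" by (simp add: vimage_def)
qed

text \<open>The difference quotients \<open>(Q (t, u) - Q (t, 0)) / u\<close> are holomorphic in \<open>t\<close>. By Cauchy's
  inequality the second derivative in \<open>u\<close> is bounded on a polydisc, so by Taylor's formula they
  converge uniformly to the partial derivative as \<open>u\<close> tends to zero, which is therefore
  holomorphic too.\<close>
lemma holomorphic_on_partial_deriv:
  fixes Q :: "complex^2 \<Rightarrow> complex"
  assumes Q: "Q mholomorphic_on V" and T: "open T" "\<And>t. t \<in> T \<Longrightarrow> pt t 0 \<in> V"
  shows "(\<lambda>t. deriv (\<lambda>u. Q (pt t u)) 0) holomorphic_on T"
proof -
  define D where "D = (\<lambda>t. deriv (\<lambda>u. Q (pt t u)) 0)"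
  have V: "open V" using Q by (simp add: mholomorphic_on_def)
  have "D field_differentiable at t0" if t0: "t0 \<in> T" for t0
  proof -
    have "(t0, 0) \<in> {z. pt (fst z) (snd z) \<in> V}" using T t0 by simp
    from open_prod_elim[OF open_pt_vimage[OF V] this]
    obtain X Y where XY: "open X" "open Y" "(t0, 0) \<in> X \<times> Y"
        "X \<times> Y \<subseteq> {z. pt (fst z) (snd z) \<in> V}" .
    obtain r1 where r1: "r1 > 0" "cball t0 r1 \<subseteq> X"
      using XY(1,3) open_contains_cball by blast
    obtain r2 where r2: "r2 > 0" "cball 0 r2 \<subseteq> Y"
      using XY(2,3) open_contains_cball by blast
    note r12 = r1 r2
    define r where "r = min r1 r2"
    have r: "r > 0" using r12 by (simp add: r_def)
    have inV: "pt t u \<in> V" if "t \<in> cball t0 r" "u \<in> cball 0 r" for t u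
      using that r12 XY(4) by (auto simp: r_def subset_iff)
    have "compact ((\<lambda>z. Q (pt (fst z) (snd z))) ` (cball t0 r \<times> cball 0 r))"
    proof (rule compact_continuous_image[OF _ compact_Times[OF compact_cball compact_cball]])
      show "continuous_on (cball t0 r \<times> cball 0 r) (\<lambda>z. Q (pt (fst z) (snd z)))"
      proof (rule continuous_on_compose2[OF mholomorphic_on_imp_continuous_on[OF Q] continuous_on_pt])
        show "(\<lambda>z. pt (fst z) (snd z)) ` (cball t0 r \<times> cball 0 r) \<subseteq> V"
          using inV by auto
      qed
    qed
    then obtain M where "\<forall>z\<in>cball t0 r \<times> cball 0 r. cmod (Q (pt (fst z) (snd z))) \<le> M"
      unfolding compact_eq_bounded_closed bounded_iff by blast
    hence M: "cmod (Q (pt t u)) \<le> M" if "t \<in> cball t0 r" "u \<in> cball 0 r" for t u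
      using that by simp
    \<comment> \<open>the bound of Cauchy's inequality for the second derivative on discs of radius \<open>r/2\<close>\<close>
    define C where "C = fact 2 * M / (r/2)^2"
    have taylor: "cmod (Q (pt t u) - (Q (pt t 0) + D t * u)) \<le> C * cmod u ^ 2"
      if t: "t \<in> cball t0 r" and u: "u \<in> cball 0 (r/2)" for t u
    proof -
      define q where "q = (\<lambda>u. Q (pt t u))"
      have hol: "q holomorphic_on ball 0 r"
        unfolding holomorphic_on_open[OF open_ball] q_def field_differentiable_def[symmetric]
        using mholomorphic_on_slice2[OF Q] inV[OF t] by auto
      have "cmod ((deriv ^^ 0) q u - (\<Sum>i\<le>1. (deriv ^^ i) q 0 * (u - 0) ^ i / fact i)) \<le> C * cmod (u - 0) ^ Suc 1 / fact 1"
      proof (rule complex_Taylor[where S = "cball 0 (r/2)" and f = "\<lambda>i. (deriv ^^ i) q"])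
        fix i and x :: complex assume "x \<in> cball 0 (r/2)"
        hence x: "x \<in> ball 0 r" using r by auto
        have "((deriv ^^ i) q) holomorphic_on ball 0 r"
          by (intro holomorphic_higher_deriv hol) auto
        from holomorphic_derivI[OF this open_ball x]
        show "((deriv ^^ i) q has_field_derivative (deriv ^^ Suc i) q x) (at x within cball 0 (r/2))"
          by (auto intro: has_field_derivative_at_within)
      next
        fix x :: complex assume x: "x \<in> cball 0 (r/2)"
        have sub: "cball x (r/2) \<subseteq> cball 0 r" and sub': "ball x (r/2) \<subseteq> ball 0 r"
          using x r by (auto simp: cball_subset_cball_iff ball_subset_ball_iff)
        have "cmod ((deriv ^^ 2) q x) \<le> fact 2 * M / (r/2)^2"
        proof (rule Cauchy_inequality)
          show "q holomorphic_on ball x (r/2)" using hol sub' by (rule holomorphic_on_subset)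
          have "continuous_on (cball 0 r) q"
            using mholomorphic_on_slice2[OF Q inV[OF t]]
            by (intro continuous_at_imp_continuous_on) (auto simp: q_def field_differentiable_imp_continuous_at)
          thus "continuous_on (cball x (r/2)) q" using sub by (rule continuous_on_subset)
          show "cmod (q y) \<le> M" if "cmod (x - y) = r/2" for y
            using sub that M[OF t, of y] by (auto simp: q_def dist_norm subset_iff)
        qed (use r in auto)
        thus "cmod ((deriv ^^ Suc 1) q x) \<le> C" by (simp add: C_def numeral_2_eq_2)
      qed (use u r in auto)
      thus ?thesis by (simp add: q_def D_def power2_eq_square)
    qed
    define \<delta> where "\<delta> = (\<lambda>n. r / 2 / real (Suc n))"
    have \<delta>: "\<delta> n > 0" "\<delta> n \<le> r/2" for n
      using r by (auto simp: \<delta>_def field_simps)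
    have \<delta>0: "\<delta> \<longlonglongrightarrow> 0"
      unfolding \<delta>_def by (rule LIMSEQ_Suc[OF lim_const_over_n])
    define g where "g = (\<lambda>n t. (Q (pt t (of_real (\<delta> n))) - Q (pt t 0)) / of_real (\<delta> n))"
    have err: "cmod (g n t - D t) \<le> C * \<delta> n" if "t \<in> cball t0 r" for n t
    proof -
      have "g n t - D t = (Q (pt t (of_real (\<delta> n))) - (Q (pt t 0) + D t * of_real (\<delta> n))) / of_real (\<delta> n)"
        using \<delta>(1)[of n] by (simp add: g_def field_simps)
      also have "cmod \<dots> \<le> C * \<delta> n ^ 2 / \<delta> n"
        using taylor[OF that, of "of_real (\<delta> n)"] \<delta>[of n] by (auto simp: norm_divide divide_right_mono)
      finally show ?thesis using \<delta>(1)[of n] by (simp add: power2_eq_square)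
    qed
    have "D holomorphic_on ball t0 r"
    proof (rule holomorphic_uniform_sequence[OF open_ball])
      fix n
      have "(\<lambda>t. Q (pt t u)) holomorphic_on ball t0 r" if "u \<in> cball 0 r" for u
        unfolding holomorphic_on_open[OF open_ball] field_differentiable_def[symmetric]
        using mholomorphic_on_slice1[OF Q inV] that by auto
      thus "g n holomorphic_on ball t0 r"
        unfolding g_def using \<delta>[of n] r by (intro holomorphic_intros) auto
    next
      fix x assume "x \<in> ball t0 r"
      then obtain d where d: "d > 0" "cball x d \<subseteq> ball t0 r"
        using open_contains_cball open_ball by metis
      have "uniform_limit (cball x d) g D sequentially"
      proof (rule uniform_limitI)
        fix e :: real assume "e > 0"
        moreover have "(\<lambda>n. C * \<delta> n) \<longlonglongrightarrow> C * 0" by (intro tendsto_intros \<delta>0)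
        ultimately have "\<forall>\<^sub>F n in sequentially. C * \<delta> n < e" by (simp add: order_tendstoD)
        thus "\<forall>\<^sub>F n in sequentially. \<forall>y\<in>cball x d. dist (g n y) (D y) < e"
        proof eventually_elim
          case (elim n)
          show ?case
          proof
            fix y assume "y \<in> cball x d"
            hence "y \<in> cball t0 r" using d by auto
            from err[OF this, of n] elim show "dist (g n y) (D y) < e" by (simp add: dist_norm)
          qed
        qed
      qed
      thus "\<exists>d>0. cball x d \<subseteq> ball t0 r \<and> uniform_limit (cball x d) g D sequentially"
        using d by blast
    qed
    thus ?thesis using r holomorphic_on_imp_differentiable_at[of D "ball t0 r" t0] by auto
  qed
  hence "D holomorphic_on T"
    using T(1) by (simp add: holomorphic_on_def field_differentiable_at_within)
  thus ?thesis by (simp add: D_def)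
qed

section \<open>Transverse derivatives in adapted coordinates\<close>

text \<open>Transverse derivative of \<open>f\<close> from the coordinates \<open>\<psi>\<close> to the coordinates \<open>\<psi>'\<close>. Allowing two
  different coordinate systems, and also \<open>f = id\<close>, turns the change of coordinates into another
  instance of the same notion, so that one chain rule covers everything.\<close>
definition coord_deriv ::
    "complex set \<Rightarrow> complex set \<Rightarrow> (complex \<Rightarrow> complex \<Rightarrow> cp2) \<Rightarrow> (cp2 \<Rightarrow> cp2) \<Rightarrow>
     (complex \<Rightarrow> complex \<Rightarrow> cp2) \<Rightarrow> complex \<Rightarrow> complex"
  where "coord_deriv A' B' \<psi>' f \<psi> t = deriv (\<lambda>u. u_coord A' B' \<psi>' (f (\<psi> t u))) 0"

lemma transverse_deriv_eq_coord_deriv: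
  "transverse_deriv F A B \<psi> = coord_deriv A B \<psi> (rat_map F) \<psi>"
  by (simp add: fun_eq_iff transverse_deriv_def coord_deriv_def)

lemma shift_of_int_iff:
  fixes A :: "complex set"
  assumes "\<And>t. t \<in> A \<longleftrightarrow> t + 1 \<in> A"
  shows "t + of_int n \<in> A \<longleftrightarrow> t \<in> A"
proof (induction n rule: int_induct[where k = 0])
  case (step1 i) thus ?case using assms[of "t + of_int i"] by (simp add: add.assoc)
next
  case (step2 i) thus ?case using assms[of "t + of_int (i - 1)"] by (simp add: add.assoc)
qed simp

locale annulus =
  fixes h0 h1 :: ereal and \<iota> :: "complex \<Rightarrow> cp2"
  assumes embedded: "embedded_annulus h0 h1 \<iota>"
begin

text \<open>\<open>f\<close> has the holomorphic lift \<open>G\<close>, whose zeros avoid the ring, and rotates the ring by \<open>\<beta>\<close>. The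
  instances of interest are the given rational map and the identity (with \<open>\<beta> = 0\<close>).\<close>
definition rotates :: "(complex^3 \<Rightarrow> complex^3) \<Rightarrow> (cp2 \<Rightarrow> cp2) \<Rightarrow> real \<Rightarrow> bool"
  where "rotates G f \<beta> \<longleftrightarrow> (\<forall>i. (\<lambda>v. G v $ i) mholomorphic_on UNIV) \<and>
    (\<forall>v. v \<noteq> 0 \<longrightarrow> f (proj v) = proj (G v)) \<and>
    (\<forall>t\<in>cylinder h0 h1. \<forall>v. v \<noteq> 0 \<and> proj v = \<iota> t \<longrightarrow> G v \<noteq> 0) \<and>
    (\<forall>t\<in>cylinder h0 h1. f (\<iota> t) = \<iota> (t + of_real \<beta>))"

text \<open>The parameters at which \<open>u = 0\<close> describes the ring and \<open>t\<close> is the canonical parameter. The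
  definition of adapted coordinates yields this on the circle itself; \<open>ring_part_open\<close> extends it
  to a neighbourhood.\<close>
definition ring_part :: "complex set \<Rightarrow> (complex \<Rightarrow> complex \<Rightarrow> cp2) \<Rightarrow> complex set"
  where "ring_part A \<psi> = {t \<in> A \<inter> cylinder h0 h1. \<psi> t 0 = \<iota> t}"

lemma \<iota>_eq_iff: "s \<in> cylinder h0 h1 \<Longrightarrow> t \<in> cylinder h0 h1 \<Longrightarrow> \<iota> s = \<iota> t \<longleftrightarrow> s - t \<in> \<int>"
  using embedded unfolding embedded_annulus_def by simp

lemma cylinder_shift: "t + of_real x \<in> cylinder h0 h1 \<longleftrightarrow> t \<in> cylinder h0 h1"
  by (simp add: cylinder_def)

lemma \<iota>_preimage_open:
  assumes "open N" "t \<in> cylinder h0 h1" "\<iota> t \<in> N"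
  obtains V where "open V" "t \<in> V" "V \<subseteq> cylinder h0 h1" "\<iota> ` V \<subseteq> N"
proof -
  obtain V \<Phi> where V: "open V" "t \<in> V" "V \<subseteq> cylinder h0 h1"
     and hol: "\<And>i. (\<lambda>s. \<Phi> s $ i) holomorphic_on V"
     and lift: "\<And>s. s \<in> V \<Longrightarrow> \<Phi> s \<noteq> 0 \<and> \<iota> s = proj (\<Phi> s)"
    using embedded[unfolded embedded_annulus_def, THEN conjunct2, THEN conjunct2, THEN conjunct1,
        rule_format, OF assms(2)] by blast
  have "continuous_on V (\<lambda>s. \<chi> i. \<Phi> s $ i)"
    by (intro continuous_on_vec_lambda holomorphic_on_imp_continuous_on hol)
  hence cont: "continuous_on V \<Phi>" by simp
  have "open (cone N)" using assms(1) by (simp add: open_cp2_def)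
  hence "open (\<Phi> -` cone N \<inter> V)"
    using continuous_on_open_vimage[OF V(1)] cont by blast
  moreover have "t \<in> \<Phi> -` cone N \<inter> V" using V lift assms(3) by (auto simp: cone_def)
  moreover have "\<iota> ` (\<Phi> -` cone N \<inter> V) \<subseteq> N" using lift by (auto simp: cone_def)
  ultimately show ?thesis using that V(3) by blast
qed

lemma rotates_id: "rotates (\<lambda>v. v) (\<lambda>p. p) 0"
  by (auto simp: rotates_def intro: mholomorphic_on_component)

lemma rotates_rat_map:
  assumes "rational_map F" "herman_ring F H h0 h1 \<iota> \<alpha>"
  shows "rotates F (rat_map F) \<alpha>"
  unfolding rotates_def
proof (intro conjI allI ballI impI)
  show "(\<lambda>v. F v $ i) mholomorphic_on UNIV" for i
    using assms(1) homogeneous_poly_mholomorphic by (auto simp: rational_map_def)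
  show "rat_map F (proj v) = proj (F v)" if "v \<noteq> 0" for v
    using rat_map_proj[OF assms(1) that] .
  show "F v \<noteq> 0" if "t \<in> cylinder h0 h1" "v \<noteq> 0 \<and> proj v = \<iota> t" for t v
  proof
    assume "F v = 0"
    with that(2) have "\<iota> t \<in> indeterminacy F" unfolding indeterminacy_def by (metis (mono_tags, lifting) mem_Collect_eq)
    thus False using assms(2) that(1) by (auto simp: herman_ring_def)
  qed
  show "rat_map F (\<iota> t) = \<iota> (t + of_real \<alpha>)" if "t \<in> cylinder h0 h1" for t
    using assms(2) that by (auto simp: herman_ring_def)
qed

end

locale ring_coords = annulus +
  fixes h :: real and A B :: "complex set" and \<psi> :: "complex \<Rightarrow> complex \<Rightarrow> cp2"
  assumes adapted: "adapted_coordinates h0 h1 \<iota> h A B \<psi>" and height: "h \<in> heights h0 h1"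
begin

lemma
  shows A_open: "open A" and A_shift1: "t \<in> A \<longleftrightarrow> t + 1 \<in> A" and B_open: "open B" and B_0: "0 \<in> B"
    and \<psi>_eq_iff: "\<lbrakk>t \<in> A; t' \<in> A; u \<in> B; u' \<in> B\<rbrakk> \<Longrightarrow> \<psi> t u = \<psi> t' u' \<longleftrightarrow> t - t' \<in> \<int> \<and> u = u'"
    and \<psi>_hol: "holomorphic_into_cp2 (\<lambda>p :: complex^2. \<psi> (p$1) (p$2)) {p. p$1 \<in> A \<and> p$2 \<in> B}"
    and \<psi>_inverse: "\<lbrakk>t \<in> A; u \<in> B\<rbrakk> \<Longrightarrow> \<exists>N \<tau> \<mu>. \<psi> t u \<in> N \<and>
        holomorphic_from_cp2 \<tau> N \<and> holomorphic_from_cp2 \<mu> N \<and>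
        (\<forall>p\<in>N. \<tau> p \<in> A \<and> \<mu> p \<in> B \<and> \<psi> (\<tau> p) (\<mu> p) = p)"
    and circle_in_image: "Im t = h \<Longrightarrow> \<exists>t'\<in>A. \<exists>u\<in>B. \<iota> t = \<psi> t' u"
    and ring_is_zero: "\<lbrakk>t \<in> A; u \<in> B; s \<in> cylinder h0 h1; \<psi> t u = \<iota> s\<rbrakk> \<Longrightarrow> u = 0 \<and> t - s \<in> \<int>"
proof -
  note D = adapted[unfolded adapted_coordinates_def]
  from D show "open A" "t \<in> A \<longleftrightarrow> t + 1 \<in> A" "open B" "0 \<in> B"
    "holomorphic_into_cp2 (\<lambda>p :: complex^2. \<psi> (p$1) (p$2)) {p. p$1 \<in> A \<and> p$2 \<in> B}"
    by simp_all
  from D show "\<lbrakk>t \<in> A; t' \<in> A; u \<in> B; u' \<in> B\<rbrakk> \<Longrightarrow> \<psi> t u = \<psi> t' u' \<longleftrightarrow> t - t' \<in> \<int> \<and> u = u'"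
    by simp
  from D show "\<lbrakk>t \<in> A; u \<in> B\<rbrakk> \<Longrightarrow> \<exists>N \<tau> \<mu>. \<psi> t u \<in> N \<and>
        holomorphic_from_cp2 \<tau> N \<and> holomorphic_from_cp2 \<mu> N \<and>
        (\<forall>p\<in>N. \<tau> p \<in> A \<and> \<mu> p \<in> B \<and> \<psi> (\<tau> p) (\<mu> p) = p)" by simp
  from D show "Im t = h \<Longrightarrow> \<exists>t'\<in>A. \<exists>u\<in>B. \<iota> t = \<psi> t' u" by simp
  from D show "\<lbrakk>t \<in> A; u \<in> B; s \<in> cylinder h0 h1; \<psi> t u = \<iota> s\<rbrakk> \<Longrightarrow> u = 0 \<and> t - s \<in> \<int>" by simp
qed

lemma A_shift: "t + of_int n \<in> A \<longleftrightarrow> t \<in> A"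
  by (rule shift_of_int_iff[OF A_shift1])

lemma \<psi>_shift: "t \<in> A \<Longrightarrow> u \<in> B \<Longrightarrow> \<psi> (t + of_int n) u = \<psi> t u"
  by (subst \<psi>_eq_iff) (auto simp: A_shift)

lemma u_coord_\<psi>: "t \<in> A \<Longrightarrow> u \<in> B \<Longrightarrow> u_coord A B \<psi> (\<psi> t u) = u"
  unfolding u_coord_def using \<psi>_eq_iff by (intro the_equality) blast+

text \<open>A point of the ring in the image of \<open>\<psi>\<close> has \<open>u = 0\<close> and the right parameter modulo \<open>\<int>\<close>; by
  injectivity of \<open>\<psi>\<close> modulo \<open>\<int>\<close> the integer translation is harmless.\<close>
lemma ring_partI:
  assumes "t \<in> cylinder h0 h1" "t' \<in> A" "u \<in> B" "\<iota> t = \<psi> t' u"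
  shows "t \<in> ring_part A \<psi>"
proof -
  have *: "u = 0" "t' - t \<in> \<int>" using ring_is_zero[of t' u t] assms by auto
  then obtain n where "t' - t = of_int n" by (auto elim: Ints_cases)
  hence n: "t' = t + of_int n" by (simp add: algebra_simps)
  hence "t \<in> A" using assms(2) A_shift by simp
  moreover from this have "\<psi> t' u = \<psi> t 0" using \<psi>_shift B_0 * n by simp
  ultimately show ?thesis using assms by (simp add: ring_part_def)
qed

lemma line_subset_ring_part: "Im t = h \<Longrightarrow> t \<in> ring_part A \<psi>"
  using circle_in_image[of t] height ring_partI[of t] by (auto simp: cylinder_def)

text \<open>The local inverses of \<open>\<psi>\<close> are defined on open sets, hence the image of \<open>\<psi>\<close> is a neighbourhood of
  each of its points on the ring, and \<open>\<iota>\<close> is continuous.\<close>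
lemma ring_part_open: "open (ring_part A \<psi>)"
proof (subst open_subopen, intro ballI)
  fix t assume t: "t \<in> ring_part A \<psi>"
  hence tA: "t \<in> A" "t \<in> cylinder h0 h1" "\<psi> t 0 = \<iota> t" by (auto simp: ring_part_def)
  obtain N \<tau> \<mu> where N: "\<psi> t 0 \<in> N" "holomorphic_from_cp2 \<tau> N"
      "\<And>p. p\<in>N \<Longrightarrow> \<tau> p \<in> A \<and> \<mu> p \<in> B \<and> \<psi> (\<tau> p) (\<mu> p) = p"
    using \<psi>_inverse[OF tA(1) B_0] by blast
  have "open N" using N(2) by (simp add: holomorphic_from_cp2_def)
  then obtain V where V: "open V" "t \<in> V" "V \<subseteq> cylinder h0 h1" "\<iota> ` V \<subseteq> N"
    using \<iota>_preimage_open[of N t] tA N(1) by metis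
  have "V \<subseteq> ring_part A \<psi>"
  proof
    fix s assume "s \<in> V"
    hence "\<iota> s \<in> N" "s \<in> cylinder h0 h1" using V by auto
    moreover from this have "\<tau> (\<iota> s) \<in> A" "\<mu> (\<iota> s) \<in> B" "\<iota> s = \<psi> (\<tau> (\<iota> s)) (\<mu> (\<iota> s))"
      using N(3)[of "\<iota> s"] by metis+
    ultimately show "s \<in> ring_part A \<psi>" by (intro ring_partI)
  qed
  thus "\<exists>T. open T \<and> t \<in> T \<and> T \<subseteq> ring_part A \<psi>" using V by blast
qed

lemma ring_part_shift: "t + of_int n \<in> ring_part A \<psi> \<longleftrightarrow> t \<in> ring_part A \<psi>"
proof -
  have cyl: "t + of_int n \<in> cylinder h0 h1 \<longleftrightarrow> t \<in> cylinder h0 h1"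
    by (simp add: cylinder_def)
  show ?thesis
  proof (cases "t \<in> A \<inter> cylinder h0 h1")
    case True
    hence "\<iota> (t + of_int n) = \<iota> t" using cyl by (subst \<iota>_eq_iff) simp_all
    moreover have "\<psi> (t + of_int n) 0 = \<psi> t 0" using True \<psi>_shift B_0 by simp
    ultimately show ?thesis by (simp add: ring_part_def A_shift cyl)
  next
    case False
    thus ?thesis unfolding ring_part_def using A_shift cyl by blast
  qed
qed

lemma coord_deriv_periodic:
  assumes "t \<in> A"
  shows "coord_deriv A' B' \<psi>' f \<psi> (t + of_int n) = coord_deriv A' B' \<psi>' f \<psi> t"
  unfolding coord_deriv_def
proof (rule deriv_cong_ev)
  have "eventually (\<lambda>u. u \<in> B) (nhds 0)"
    using B_open B_0 eventually_nhds by blast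
  thus "\<forall>\<^sub>F u in nhds 0. u_coord A' B' \<psi>' (f (\<psi> (t + of_int n) u)) = u_coord A' B' \<psi>' (f (\<psi> t u))"
    by eventually_elim (simp add: \<psi>_shift assms)
qed simp

lemma coord_deriv_id:
  assumes "t \<in> A"
  shows "coord_deriv A B \<psi> (\<lambda>p. p) \<psi> t = 1"
proof -
  have "eventually (\<lambda>u. u \<in> B) (nhds 0)"
    using B_open B_0 eventually_nhds by blast
  hence "\<forall>\<^sub>F u in nhds 0. u_coord A B \<psi> (\<psi> t u) = u"
    by eventually_elim (simp add: u_coord_\<psi> assms)
  hence "coord_deriv A B \<psi> (\<lambda>p. p) \<psi> t = deriv (\<lambda>u. u) 0"
    unfolding coord_deriv_def by (rule deriv_cong_ev) simp
  thus ?thesis by simp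
qed

end

locale two_coords = X: ring_coords h0 h1 \<iota> h A B \<psi> + Y: ring_coords h0 h1 \<iota> h' A' B' \<psi>'
  for h0 h1 \<iota> h A B \<psi> h' A' B' \<psi>'
begin

text \<open>Near \<open>(t, 0)\<close> the map reads \<open>(t, u) \<mapsto> (a, b)\<close> with \<open>a\<close>, \<open>b\<close> holomorphic: compose a local lift of
  \<open>\<psi>\<close> to \<open>\<complex>\<^sup>3\<close>, the lift \<open>G\<close>, and a local inverse of \<open>\<psi>'\<close>.\<close>
lemma map_in_coordinates:
  assumes f: "X.rotates G f \<beta>" and t: "t \<in> X.ring_part A \<psi>" "t + of_real \<beta> \<in> X.ring_part A' \<psi>'"
  obtains V a b where "open V" "pt t 0 \<in> V" "a mholomorphic_on V" "b mholomorphic_on V"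
    "\<And>q. q \<in> V \<Longrightarrow> q $ 1 \<in> A \<and> q $ 2 \<in> B \<and> a q \<in> A' \<and> b q \<in> B' \<and> \<psi>' (a q) (b q) = f (\<psi> (q $ 1) (q $ 2))"
proof -
  have t': "t \<in> A" "t \<in> cylinder h0 h1" "\<psi> t 0 = \<iota> t" "t + of_real \<beta> \<in> A'" "\<psi>' (t + of_real \<beta>) 0 = \<iota> (t + of_real \<beta>)"
    using t by (auto simp: X.ring_part_def)
  have G: "\<And>i. (\<lambda>v. G v $ i) mholomorphic_on UNIV" "\<And>v. v \<noteq> 0 \<Longrightarrow> f (proj v) = proj (G v)"
      "\<And>v. v \<noteq> 0 \<Longrightarrow> proj v = \<iota> t \<Longrightarrow> G v \<noteq> 0" "f (\<iota> t) = \<iota> (t + of_real \<beta>)"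
    using f t'(2) unfolding X.rotates_def by simp_all
  have pt: "pt t 0 \<in> {p :: complex^2. p$1 \<in> A \<and> p$2 \<in> B}" using t' X.B_0 by simp
  from X.\<psi>_hol[unfolded holomorphic_into_cp2_def, THEN conjunct2, rule_format, OF pt]
  obtain V0 and \<Phi> :: "complex^2 \<Rightarrow> complex^3" where V0: "open V0" "pt t 0 \<in> V0" "V0 \<subseteq> {p. p$1 \<in> A \<and> p$2 \<in> B}"
      and \<Phi>: "\<And>i. (\<lambda>q. \<Phi> q $ i) mholomorphic_on V0"
      and lift: "\<And>q. q \<in> V0 \<Longrightarrow> \<Phi> q \<noteq> 0 \<and> \<psi> (q$1) (q$2) = proj (\<Phi> q)"
    by blast
  obtain N \<tau> \<mu> where N: "\<psi>' (t + of_real \<beta>) 0 \<in> N" "holomorphic_from_cp2 \<tau> N" "holomorphic_from_cp2 \<mu> N"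
      "\<And>p. p\<in>N \<Longrightarrow> \<tau> p \<in> A' \<and> \<mu> p \<in> B' \<and> \<psi>' (\<tau> p) (\<mu> p) = p"
    using Y.\<psi>_inverse[OF t'(4) Y.B_0] by blast
  have "open (cone N)" using N(2) by (simp add: holomorphic_from_cp2_def open_cp2_def)
  define \<Psi> where "\<Psi> = (\<lambda>q. G (\<Phi> q))"
  have \<Psi>: "(\<lambda>q. \<Psi> q $ i) mholomorphic_on V0" for i
    unfolding \<Psi>_def by (rule mholomorphic_on_compose[OF \<Phi> G(1)]) simp
  define V where "V = \<Psi> -` cone N \<inter> V0"
  have V: "open V" unfolding V_def
    using continuous_on_open_vimage[OF V0(1)] mholomorphic_on_vec_continuous_on[OF \<Psi>] \<open>open (cone N)\<close>
    by blast
  have "\<Phi> (pt t 0) \<noteq> 0" "proj (\<Phi> (pt t 0)) = \<iota> t"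
    using lift[OF V0(2)] t'(3) by auto
  hence "\<Psi> (pt t 0) \<in> cone N"
    using N(1) t' G unfolding cone_def \<Psi>_def by (auto dest: sym)
  hence ptV: "pt t 0 \<in> V" using V0 by (simp add: V_def)
  have \<Psi>V: "(\<lambda>q. \<Psi> q $ i) mholomorphic_on V" for i
    by (rule mholomorphic_on_subset[OF \<Psi> V]) (auto simp: V_def)
  have comp: "(\<lambda>q. g (proj (\<Psi> q))) mholomorphic_on V" if "holomorphic_from_cp2 g N" for g
    by (rule mholomorphic_on_compose[OF \<Psi>V, of "\<lambda>v. g (proj v)" "cone N"])
       (use that in \<open>auto simp: holomorphic_from_cp2_def V_def\<close>)
  show ?thesis
  proof (rule that[OF V ptV comp[OF N(2)] comp[OF N(3)]])
    fix q assume q: "q \<in> V"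
    hence "proj (\<Psi> q) \<in> N" by (simp add: V_def cone_def)
    moreover have "f (\<psi> (q$1) (q$2)) = proj (\<Psi> q)"
      using q lift[of q] G(2) by (simp add: V_def \<Psi>_def)
    ultimately show "q $ 1 \<in> A \<and> q $ 2 \<in> B \<and> \<tau> (proj (\<Psi> q)) \<in> A' \<and> \<mu> (proj (\<Psi> q)) \<in> B' \<and>
        \<psi>' (\<tau> (proj (\<Psi> q))) (\<mu> (proj (\<Psi> q))) = f (\<psi> (q$1) (q$2))"
      using N(4)[of "proj (\<Psi> q)"] q V0(3) by (auto simp: V_def)
  qed
qed

lemma coord_deriv_eq_partial:
  assumes b: "b mholomorphic_on V" "pt s 0 \<in> V"
    and V: "\<And>q. q \<in> V \<Longrightarrow> a q \<in> A' \<and> b q \<in> B' \<and> \<psi>' (a q) (b q) = f (\<psi> (q $ 1) (q $ 2))"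
  shows "coord_deriv A' B' \<psi>' f \<psi> s = deriv (\<lambda>u. b (pt s u)) 0"
  unfolding coord_deriv_def
proof (rule deriv_cong_ev)
  have "open {u. pt s u \<in> V}" using b(1) unfolding mholomorphic_on_def by (blast intro: open_pt_slices)
  hence "\<forall>\<^sub>F u in nhds 0. pt s u \<in> V" using b(2) eventually_nhds_in_open[of "{u. pt s u \<in> V}" 0] by simp
  thus "\<forall>\<^sub>F u in nhds 0. u_coord A' B' \<psi>' (f (\<psi> s u)) = b (pt s u)"
  proof eventually_elim
    case (elim u)
    from V[OF this] show ?case using Y.u_coord_\<psi>[of "a (pt s u)" "b (pt s u)"] by simp
  qed
qed simp

lemma coord_deriv_field_differentiable:
  assumes f: "X.rotates G f \<beta>" and t: "t \<in> X.ring_part A \<psi>" "t + of_real \<beta> \<in> X.ring_part A' \<psi>'"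
  shows "coord_deriv A' B' \<psi>' f \<psi> field_differentiable at t"
proof -
  obtain V a b where V: "open V" "pt t 0 \<in> V" "a mholomorphic_on V" "b mholomorphic_on V"
    "\<And>q. q \<in> V \<Longrightarrow> q $ 1 \<in> A \<and> q $ 2 \<in> B \<and> a q \<in> A' \<and> b q \<in> B' \<and> \<psi>' (a q) (b q) = f (\<psi> (q $ 1) (q $ 2))"
    by (rule map_in_coordinates[OF assms]) blast
  define T where "T = {s. pt s 0 \<in> V}"
  have T: "open T" "t \<in> T" using open_pt_slices[OF V(1)] V(2) by (auto simp: T_def)
  have "(\<lambda>s. deriv (\<lambda>u. b (pt s u)) 0) holomorphic_on T"
    by (rule holomorphic_on_partial_deriv[OF V(4) T(1)]) (simp add: T_def)
  moreover have "deriv (\<lambda>u. b (pt s u)) 0 = coord_deriv A' B' \<psi>' f \<psi> s" if "s \<in> T" for s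
  proof (rule coord_deriv_eq_partial[symmetric])
    show "b mholomorphic_on V" by (rule V(4))
    show "pt s 0 \<in> V" using that by (simp add: T_def)
    show "a q \<in> A' \<and> b q \<in> B' \<and> \<psi>' (a q) (b q) = f (\<psi> (q $ 1) (q $ 2))" if "q \<in> V" for q
      using V(5)[OF that] by blast
  qed
  ultimately have "coord_deriv A' B' \<psi>' f \<psi> holomorphic_on T"
    by (rule holomorphic_transform)
  thus ?thesis using T holomorphic_on_imp_differentiable_at by blast
qed

end

text \<open>The chain rule for transverse derivatives. Only the transverse components enter because each
  map sends the line \<open>u = 0\<close> to itself: in the full chain rule, the term with the derivative of
  the transverse component in the direction of the ring drops out.\<close>
lemma (in annulus) coord_deriv_compose:
  assumes X: "ring_coords h0 h1 \<iota> h A B \<psi>" and Y: "ring_coords h0 h1 \<iota> h' A' B' \<psi>'"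
    and Z: "ring_coords h0 h1 \<iota> h'' A'' B'' \<psi>''"
    and f: "rotates G f \<beta>" and g: "rotates G' g \<gamma>"
    and t: "t \<in> ring_part A \<psi>" "t + of_real \<beta> \<in> ring_part A' \<psi>'"
       "t + of_real \<beta> + of_real \<gamma> \<in> ring_part A'' \<psi>''"
  shows "coord_deriv A'' B'' \<psi>'' (\<lambda>p. g (f p)) \<psi> t =
         coord_deriv A'' B'' \<psi>'' g \<psi>' (t + of_real \<beta>) * coord_deriv A' B' \<psi>' f \<psi> t"
proof -
  interpret X: ring_coords h0 h1 \<iota> h A B \<psi> by (rule X)
  interpret Y: ring_coords h0 h1 \<iota> h' A' B' \<psi>' by (rule Y)
  interpret Z: ring_coords h0 h1 \<iota> h'' A'' B'' \<psi>'' by (rule Z)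
  interpret XY: two_coords h0 h1 \<iota> h A B \<psi> h' A' B' \<psi>' by unfold_locales
  interpret YZ: two_coords h0 h1 \<iota> h' A' B' \<psi>' h'' A'' B'' \<psi>'' by unfold_locales
  obtain V a b where V: "open V" "pt t 0 \<in> V" "a mholomorphic_on V" "b mholomorphic_on V"
    "\<And>q. q \<in> V \<Longrightarrow> q $ 1 \<in> A \<and> q $ 2 \<in> B \<and> a q \<in> A' \<and> b q \<in> B' \<and> \<psi>' (a q) (b q) = f (\<psi> (q $ 1) (q $ 2))"
    by (rule XY.map_in_coordinates[OF f t(1,2)]) blast
  define a0 where "a0 = a (pt t 0)"
  have tt: "t \<in> A" "t \<in> cylinder h0 h1" "\<psi> t 0 = \<iota> t" "t + of_real \<beta> \<in> A'" "t + of_real \<beta> \<in> cylinder h0 h1"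
    using t by (auto simp: ring_part_def)
  have "\<psi>' a0 (b (pt t 0)) = \<iota> (t + of_real \<beta>)"
    using V(5)[OF V(2)] f tt by (auto simp: a0_def rotates_def)
  hence b0: "b (pt t 0) = 0" and "a0 - (t + of_real \<beta>) \<in> \<int>"
    using Y.ring_is_zero[of a0 "b (pt t 0)" "t + of_real \<beta>"] V(5)[OF V(2)] tt by (auto simp: a0_def)
  then obtain n where "a0 - (t + of_real \<beta>) = of_int n" by (auto elim: Ints_cases)
  hence n: "a0 = t + of_real \<beta> + of_int n" by (simp add: algebra_simps)
  have a0_part: "a0 \<in> ring_part A' \<psi>'" using t(2) Y.ring_part_shift n by simp
  have "a0 + of_real \<gamma> = (t + of_real \<beta> + of_real \<gamma>) + of_int n" using n by simp
  hence a0\<gamma>_part: "a0 + of_real \<gamma> \<in> ring_part A'' \<psi>''" using t(3) Z.ring_part_shift by metis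
  obtain W c d where W: "open W" "pt a0 0 \<in> W" "c mholomorphic_on W" "d mholomorphic_on W"
    "\<And>q. q \<in> W \<Longrightarrow> q $ 1 \<in> A' \<and> q $ 2 \<in> B' \<and> c q \<in> A'' \<and> d q \<in> B'' \<and> \<psi>'' (c q) (d q) = g (\<psi>' (q $ 1) (q $ 2))"
    by (rule YZ.map_in_coordinates[OF g a0_part a0\<gamma>_part]) blast
  obtain \<delta> where \<delta>: "(d has_derivative (\<lambda>w. \<Sum>i\<in>UNIV. \<delta> $ i * w $ i)) (at (pt a0 0))"
    using mholomorphic_onD[OF W(4,2)] .
  \<comment> \<open>\<open>g\<close> maps the ring to itself, so the derivative of the transverse component along the ring vanishes\<close>
  have "\<delta> $ 1 = 0"
  proof -
    have "((\<lambda>s. d (pt s 0)) has_field_derivative \<delta> $ 1) (at a0)"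
      using mholomorphic_on_curve_has_field_derivative[of d \<delta> "\<lambda>s. s" a0 "\<lambda>_. 0" 1 0] \<delta> by simp
    moreover have "((\<lambda>s. d (pt s 0)) has_field_derivative 0) (at a0)"
    proof (rule has_field_derivative_transform_within_open)
      show "((\<lambda>_. 0) has_field_derivative 0) (at a0)" by simp
      show "open ({s. pt s 0 \<in> W} \<inter> ring_part A' \<psi>')"
        by (intro open_Int open_pt_slices W Y.ring_part_open)
      show "a0 \<in> {s. pt s 0 \<in> W} \<inter> ring_part A' \<psi>'" using W a0_part by simp
      fix s assume s: "s \<in> {s. pt s 0 \<in> W} \<inter> ring_part A' \<psi>'"
      hence "s \<in> cylinder h0 h1" by (simp add: ring_part_def)
      moreover have "\<psi>'' (c (pt s 0)) (d (pt s 0)) = \<iota> (s + of_real \<gamma>)"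
        using W(5)[of "pt s 0"] s g by (auto simp: ring_part_def rotates_def)
      ultimately show "0 = d (pt s 0)"
        using Z.ring_is_zero[of "c (pt s 0)" "d (pt s 0)" "s + of_real \<gamma>"] W(5)[of "pt s 0"] s
        by (simp add: cylinder_shift)
    qed
    ultimately show ?thesis by (rule DERIV_unique)
  qed
  have "((\<lambda>s. d (pt a0 s)) has_field_derivative \<delta> $ 2) (at 0)"
    using mholomorphic_on_curve_has_field_derivative[of d \<delta> "\<lambda>_. a0" 0 "\<lambda>s. s" 0 1] \<delta> by simp
  hence dg: "coord_deriv A'' B'' \<psi>'' g \<psi>' a0 = \<delta> $ 2"
    using YZ.coord_deriv_eq_partial[of d W a0 c g] W DERIV_imp_deriv by fastforce
  have da: "((\<lambda>u. a (pt t u)) has_field_derivative deriv (\<lambda>u. a (pt t u)) 0) (at 0)"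
    and db: "((\<lambda>u. b (pt t u)) has_field_derivative deriv (\<lambda>u. b (pt t u)) 0) (at 0)"
    using mholomorphic_on_slice2[OF V(3,2)] mholomorphic_on_slice2[OF V(4,2)]
    by (auto simp: field_differentiable_derivI)
  have df: "coord_deriv A' B' \<psi>' f \<psi> t = deriv (\<lambda>u. b (pt t u)) 0"
    using XY.coord_deriv_eq_partial[of b V t a f] V by simp
  have comp: "((\<lambda>u. d (pt (a (pt t u)) (b (pt t u)))) has_field_derivative \<delta> $ 2 * deriv (\<lambda>u. b (pt t u)) 0) (at 0)"
    using mholomorphic_on_curve_has_field_derivative[OF _ da db, of d \<delta>] \<delta> b0 \<open>\<delta> $ 1 = 0\<close>
    by (simp add: a0_def)
  have "coord_deriv A'' B'' \<psi>'' (\<lambda>p. g (f p)) \<psi> t = deriv (\<lambda>u. d (pt (a (pt t u)) (b (pt t u)))) 0"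
    unfolding coord_deriv_def
  proof (rule deriv_cong_ev)
    have "((\<lambda>u. (a (pt t u), b (pt t u))) \<longlongrightarrow> (a (pt t 0), b (pt t 0))) (nhds 0)"
      using isCont_Pair[OF DERIV_isCont[OF da] DERIV_isCont[OF db]]
        tendsto_at_iff_tendsto_nhds[of "\<lambda>u. (a (pt t u), b (pt t u))" 0]
      by (simp add: isCont_def)
    moreover have "open {z. pt (fst z) (snd z) \<in> W}" by (rule open_pt_vimage[OF W(1)])
    moreover have "(a (pt t 0), b (pt t 0)) \<in> {z. pt (fst z) (snd z) \<in> W}"
      using W(2) b0 by (simp add: a0_def)
    ultimately have "\<forall>\<^sub>F u in nhds 0. (a (pt t u), b (pt t u)) \<in> {z. pt (fst z) (snd z) \<in> W}"
      by (rule topological_tendstoD)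
    moreover have "\<forall>\<^sub>F u in nhds 0. pt t u \<in> V"
      using eventually_nhds_in_open[OF open_pt_slices(2)[OF V(1)], of 0 t] V(2) by simp
    ultimately show "\<forall>\<^sub>F u in nhds 0. u_coord A'' B'' \<psi>'' (g (f (\<psi> t u))) = d (pt (a (pt t u)) (b (pt t u)))"
    proof eventually_elim
      case (elim u)
      define q where "q = pt (a (pt t u)) (b (pt t u))"
      have q: "q \<in> W" using elim by (simp add: q_def)
      have "\<psi>'' (c q) (d q) = g (f (\<psi> t u))"
        using W(5)[OF q] V(5)[OF elim(2)] by (simp add: q_def)
      thus ?case using Z.u_coord_\<psi>[of "c q" "d q"] W(5)[OF q] by (simp flip: q_def)
    qed
  qed simp
  also have "\<dots> = \<delta> $ 2 * coord_deriv A' B' \<psi>' f \<psi> t"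
    using DERIV_imp_deriv[OF comp] df by simp
  also have "\<delta> $ 2 = coord_deriv A'' B'' \<psi>'' g \<psi>' (t + of_real \<beta>)"
    using dg n Y.coord_deriv_periodic[of "t + of_real \<beta>"] tt by simp
  finally show ?thesis .
qed

section \<open>Means over a period\<close>

text \<open>Integrability and value of the integral over a period are carried together, because the
  logarithms below are unbounded and integrability has to be tracked throughout.\<close>
definition has_mean :: "(real \<Rightarrow> real) \<Rightarrow> real \<Rightarrow> bool"
  where "has_mean f m \<longleftrightarrow> has_bochner_integral lborel (\<lambda>x. indicator {0..1} x * f x) m"

lemma has_mean_iff:
  "has_mean f m \<longleftrightarrow> set_integrable lborel {0..1} f \<and> (LINT x:{0..1}|lborel. f x) = m"
  by (simp add: has_mean_def has_bochner_integral_iff set_integrable_def set_lebesgue_integral_def)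

lemma has_mean_add: "has_mean f m \<Longrightarrow> has_mean g m' \<Longrightarrow> has_mean (\<lambda>x. f x + g x) (m + m')"
  unfolding has_mean_def distrib_left by (rule has_bochner_integral_add)

lemma has_mean_cmult: "has_mean f m \<Longrightarrow> has_mean (\<lambda>x. c * f x) (c * m)"
  unfolding has_mean_def mult.left_commute[of _ c] by (rule has_bochner_integral_mult_right)

lemma has_mean_const: "has_mean (\<lambda>_. c) c"
  by (simp add: has_mean_iff set_integrable_def set_lebesgue_integral_def)

lemma has_mean_sum:
  "(\<And>i. i \<in> I \<Longrightarrow> has_mean (f i) (m i)) \<Longrightarrow> has_mean (\<lambda>x. \<Sum>i\<in>I. f i x) (\<Sum>i\<in>I. m i)"
  unfolding has_mean_def sum_distrib_left by (rule has_bochner_integral_sum)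

lemma has_mean_cong_countable:
  assumes "has_mean f m" "countable X" "\<And>x. x \<in> {0..1} \<Longrightarrow> x \<notin> X \<Longrightarrow> f x = g x"
  shows "has_mean g m"
  using assms(1) unfolding has_mean_def
  by (subst (asm) has_bochner_integral_discrete_difference[where X = X and g = "\<lambda>x. indicator {0..1} x * g x"])
     (use assms(2,3) in \<open>auto split: split_indicator\<close>)

lemma has_mean_continuous_complex:
  assumes "continuous_on {0..1} f" "((\<lambda>x. f x :: complex) has_integral c) {0..1}"
  shows "has_mean (\<lambda>x. Re (f x)) (Re c)"
proof -
  have "set_integrable lborel {0..1} (\<lambda>x. Re (f x))"
    by (intro borel_integrable_atLeastAtMost' continuous_intros assms)
  moreover from this have "(LINT x:{0..1}|lborel. Re (f x)) = integral {0..1} (\<lambda>x. Re (f x))"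
    by (rule set_borel_integral_eq_integral)
  moreover have "((\<lambda>x. Re (f x)) has_integral Re c) {0..1}"
    using assms(2) by (rule has_integral_Re)
  ultimately show ?thesis by (simp add: has_mean_iff integral_unique)
qed

text \<open>Only a shift \<open>b\<close> with \<open>0 \<le> b < 1\<close> matters; cut the period at \<open>b\<close> and move the first piece by one
  period.\<close>
lemma has_mean_shift:
  assumes per: "\<And>x. f (x + 1) = f x" and f: "has_mean f m"
  shows "has_mean (\<lambda>x. f (x + a)) m"
proof -
  have per_int: "f (x + of_int n) = f x" for x n
  proof (induction n rule: int_induct[where k = 0])
    case (step1 i) thus ?case using per[of "x + of_int i"] by (simp add: add.assoc)
  next
    case (step2 i) thus ?case using per[of "x + of_int (i - 1)"] by (simp add: add.assoc)
  qed simp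
  define b where "b = frac a"
  have b: "0 \<le> b" "b < 1" by (auto simp: b_def frac_lt_1)
  have fb: "f (x + a) = f (x + b)" for x
    using per_int[of "x + b" "\<lfloor>a\<rfloor>"] by (simp add: b_def frac_def algebra_simps)
  define I where "I = (\<lambda>S x. indicator S x * f x)"
  have int: "integrable lborel (I {0..1})" and m: "integral\<^sup>L lborel (I {0..1}) = m"
    using f by (auto simp: has_mean_def has_bochner_integral_iff I_def)
  have sub: "has_bochner_integral lborel (I S) (integral\<^sup>L lborel (I S))"
    if "S \<subseteq> {0..1}" "S \<in> sets lborel" for S
  proof -
    have "integrable lborel (\<lambda>x. indicator S x *\<^sub>R I {0..1} x)"
      by (rule integrable_mult_indicator[OF that(2) int])
    also have "(\<lambda>x. indicator S x *\<^sub>R I {0..1} x) = I S"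
      using that(1) by (auto simp: I_def fun_eq_iff split: split_indicator)
    finally show ?thesis by (rule has_bochner_integral_integrable)
  qed
  define p q where "p = integral\<^sup>L lborel (I {0..b})" and "q = integral\<^sup>L lborel (I {b..1})"
  have p: "has_bochner_integral lborel (I {0..b}) p" and q: "has_bochner_integral lborel (I {b..1}) q"
    unfolding p_def q_def using b by (intro sub; auto)+
  have "has_bochner_integral lborel (I {0..1}) (p + q)"
    using has_bochner_integral_add[OF p q]
    by (subst has_bochner_integral_discrete_difference[where X = "{b}" and g = "\<lambda>x. I {0..b} x + I {b..1} x"])
       (use b in \<open>auto simp: I_def split: split_indicator\<close>)
  hence pq: "p + q = m" using m has_bochner_integral_integral_eq by metis
  \<comment> \<open>the period \<open>[b, 1 + b]\<close> consists of \<open>[b, 1]\<close> and the translate of \<open>[0, b]\<close>\<close>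
  have "has_bochner_integral lborel (\<lambda>x. I {0..b} (-1 + 1 * x)) (p /\<^sub>R \<bar>1\<bar>)"
    using p by (subst lborel_has_bochner_integral_real_affine_iff[symmetric]) auto
  hence p': "has_bochner_integral lborel (\<lambda>x. I {0..b} (x - 1)) p" by simp
  have per': "f (x - 1) = f x" for x using per[of "x - 1"] by simp
  have "has_bochner_integral lborel (I {b..1+b}) (p + q)"
    using has_bochner_integral_add[OF p' q]
    by (subst has_bochner_integral_discrete_difference[where X = "{1}" and g = "\<lambda>x. I {0..b} (x - 1) + I {b..1} x"])
       (use b in \<open>auto simp: I_def per' split: split_indicator\<close>)
  hence "has_bochner_integral lborel (\<lambda>x. I {b..1+b} (b + 1 * x)) (m /\<^sub>R \<bar>1\<bar>)"
    unfolding pq by (subst lborel_has_bochner_integral_real_affine_iff[symmetric]) auto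
  moreover have "I {b..1+b} (b + 1 * x) = indicator {0..1} x * f (x + a)" for x
    using fb[of x] by (auto simp: I_def add.commute split: split_indicator)
  ultimately show ?thesis by (simp add: has_mean_def)
qed

section \<open>The logarithmic mean of a single zero\<close>

text \<open>The coordinate \<open>exp (2\<pi>\<i>t)\<close> that identifies \<open>\<complex>/\<int>\<close> with the punctured plane.\<close>
definition e1 :: "complex \<Rightarrow> complex"
  where "e1 t = exp (2 * of_real pi * \<i> * t)"

lemma e1_holomorphic [holomorphic_intros]: "f holomorphic_on S \<Longrightarrow> (\<lambda>t. e1 (f t)) holomorphic_on S"
  unfolding e1_def by (intro holomorphic_intros)

lemma e1_continuous [continuous_intros]: "continuous_on S f \<Longrightarrow> continuous_on S (\<lambda>t. e1 (f t))"
  unfolding e1_def by (intro continuous_intros)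

lemma e1_nonzero [simp]: "e1 t \<noteq> 0"
  by (simp add: e1_def)

lemma e1_add: "e1 (s + t) = e1 s * e1 t"
  by (simp add: e1_def ring_distribs exp_add)

lemma norm_e1: "cmod (e1 t) = exp (- 2 * pi * Im t)"
  by (simp add: e1_def)

lemma e1_eq_iff: "e1 s = e1 t \<longleftrightarrow> s - t \<in> \<int>"
proof
  assume "e1 s = e1 t"
  then obtain n :: int where "2 * of_real pi * \<i> * s = 2 * of_real pi * \<i> * t + (of_int (2 * n) * pi) * \<i>"
    unfolding e1_def exp_eq by blast
  hence "(2 * of_real pi * \<i>) * s = (2 * of_real pi * \<i>) * (t + of_int n)"
    by (simp add: algebra_simps)
  hence "s = t + of_int n" by (subst (asm) mult_left_cancel) auto
  thus "s - t \<in> \<int>" by simp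
next
  assume "s - t \<in> \<int>"
  then obtain n where "s - t = of_int n" by (auto elim: Ints_cases)
  hence "s = t + of_int n" by (simp add: algebra_simps)
  hence "2 * of_real pi * \<i> * s = 2 * of_real pi * \<i> * t + (of_int (2 * n) * pi) * \<i>"
    by (simp add: algebra_simps)
  thus "e1 s = e1 t" unfolding e1_def exp_eq by blast
qed

text \<open>The mean value property of the harmonic function \<open>ln |1 - u|\<close>, whose value at \<open>0\<close> is \<open>0\<close>.\<close>
lemma has_mean_ln_circle_inside:
  assumes "0 < r" "r < 1"
  shows "has_mean (\<lambda>x. ln (cmod (1 - of_real r * e1 (of_real x)))) 0"
proof -
  define f where "f = (\<lambda>u. Ln (1 - u))"
  have Re_pos: "1 - u \<notin> \<real>\<^sub>\<le>\<^sub>0" if "cmod u < 1" for u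
  proof -
    have "Re u < 1" using complex_Re_le_cmod[of u] that by simp
    thus ?thesis by (auto simp: complex_nonpos_Reals_iff)
  qed
  have hol: "f holomorphic_on ball 0 1"
    unfolding f_def by (intro holomorphic_intros) (use Re_pos in auto)
  have sub: "cball 0 r \<subseteq> ball 0 1" using assms by auto
  have "((\<lambda>u. f u / (u - 0)) has_contour_integral (2 * of_real pi * \<i> * f 0)) (circlepath 0 r)"
    using assms sub ball_subset_cball[of 0 r] hol
    by (intro Cauchy_integral_circlepath holomorphic_on_imp_continuous_on)
       (auto intro: holomorphic_on_subset)
  hence "((\<lambda>x. f (circlepath 0 r x) / (circlepath 0 r x - 0) *
      vector_derivative (circlepath 0 r) (at x)) has_integral 0) {0..1}"
    by (simp only: has_contour_integral) (simp add: f_def)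
  moreover have "f (circlepath 0 r x) / (circlepath 0 r x - 0) * vector_derivative (circlepath 0 r) (at x)
      = (2 * of_real pi * \<i>) * f (of_real r * e1 (of_real x))" for x
    unfolding vector_derivative_circlepath using assms by (simp add: circlepath e1_def)
  ultimately have "((\<lambda>x. (2 * of_real pi * \<i>) * f (of_real r * e1 (of_real x))) has_integral 0) {0..1}"
    by simp
  from has_integral_mult_right[OF this, of "1 / (2 * of_real pi * \<i>)"]
  have int: "((\<lambda>x. f (of_real r * e1 (of_real x))) has_integral 0) {0..1}"
    by simp
  have in_ball: "cmod (of_real r * e1 (of_real x)) < 1" for x :: real
    using assms by (simp add: norm_mult norm_e1)
  have "continuous_on {0..1} (\<lambda>x::real. f (of_real r * e1 (of_real x)))"
    by (rule continuous_on_compose2[OF holomorphic_on_imp_continuous_on[OF hol]])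
       (use in_ball in \<open>auto intro!: continuous_intros\<close>)
  from has_mean_continuous_complex[OF this int]
  have "has_mean (\<lambda>x. Re (f (of_real r * e1 (of_real x)))) 0" by simp
  moreover have "Re (f (of_real r * e1 (of_real x))) = ln (cmod (1 - of_real r * e1 (of_real x)))" for x
    unfolding f_def using in_ball[of x] by (subst Re_Ln) auto
  ultimately show ?thesis by simp
qed

text \<open>The radius \<open>1\<close>, where the logarithm has a singularity, is the limit of radii \<open>r n\<close> below \<open>1\<close>.
  All \<open>ln |1 - r n e|\<close> are bounded above by \<open>ln 2\<close> and have mean zero, so Fatou's lemma gives the
  integrability of the limit; as \<open>|1 - e| \<le> 2 |1 - r e|\<close>, the limit in turn dominates the
  sequence, so the means converge.\<close>
lemma has_mean_ln_circle_boundary: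
  "has_mean (\<lambda>x. ln (cmod (1 - e1 (of_real x)))) 0"
proof -
  define K where "K = (\<lambda>r x. ln (cmod (1 - of_real r * e1 (of_real x))))"
  define r where "r = (\<lambda>n. 1 - 1 / real (n + 2))"
  have r: "0 < r n" "r n < 1" for n by (auto simp: r_def field_simps)
  have r_lim: "r \<longlonglongrightarrow> 1"
  proof -
    have "(\<lambda>n. 1 / real (n + 2)) \<longlonglongrightarrow> 0" by (rule LIMSEQ_ignore_initial_segment[OF lim_const_over_n])
    from tendsto_diff[OF tendsto_const this, of 1] show ?thesis by (simp add: r_def)
  qed
  have meas: "(\<lambda>x. K s x) \<in> borel_measurable lborel" for s
    unfolding K_def e1_def by measurable
  define u where "u = (\<lambda>n x. indicator {0..1} x * (ln 2 - K (r n) x))"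
  define u' where "u' = (\<lambda>x. indicator {0..1} x * (ln 2 - K 1 x))"
  have meas_u [measurable]: "u n \<in> borel_measurable lborel" "u' \<in> borel_measurable lborel" for n
    unfolding u_def u'_def using meas by measurable
  have le2: "cmod (1 - of_real s * e1 (of_real x)) \<le> 2" if "0 \<le> s" "s \<le> 1" for s x
    using norm_triangle_ineq4[of 1 "of_real s * e1 (of_real x)"] that by (simp add: norm_mult norm_e1)
  have nz: "cmod (1 - e1 (of_real x)) > 0" if "x \<in> {0..1}" "x \<notin> {0,1}" for x :: real
  proof -
    have "x \<notin> \<int>" using that by (auto elim!: Ints_cases)
    hence "of_real x \<notin> (\<int> :: complex set)" by (simp add: of_real_in_Ints_iff)
    hence "e1 (of_real x) \<noteq> e1 0" by (subst e1_eq_iff) simp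
    thus ?thesis by (auto simp: e1_def)
  qed
  have nz': "cmod (1 - of_real (r n) * e1 (of_real x)) > 0" for n and x :: real
  proof -
    have "cmod (of_real (r n) * e1 (of_real x)) < 1" using r[of n] by (simp add: norm_mult norm_e1)
    thus ?thesis by auto
  qed
  have half: "cmod (1 - e1 (of_real x)) \<le> 2 * cmod (1 - of_real s * e1 (of_real x))" if "0 \<le> s" "s \<le> 1" for s x
  proof -
    have "cmod (1 - e1 (of_real x)) \<le> cmod (1 - of_real s * e1 (of_real x)) + cmod (of_real (s - 1) * e1 (of_real x))"
      using norm_triangle_ineq[of "1 - of_real s * e1 (of_real x)" "of_real (s - 1) * e1 (of_real x)"]
      by (simp add: algebra_simps)
    also have "cmod (of_real (s - 1) * e1 (of_real x)) = 1 - s"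
      using that by (simp add: norm_mult norm_e1 del: of_real_diff)
    also have "1 - s \<le> cmod (1 - of_real s * e1 (of_real x))"
      using norm_triangle_ineq2[of 1 "of_real s * e1 (of_real x)"] that by (simp add: norm_mult norm_e1)
    finally show ?thesis by simp
  qed
  have u_nonneg: "0 \<le> u n x" for n x
    using le2[of "r n" x] r[of n] nz'[of n x]
    by (auto simp: u_def K_def split: split_indicator)
  have u'_nonneg: "0 \<le> u' x" if "x \<notin> {0,1}" for x
    using le2[of 1 x] nz[of x] that
    by (auto simp: u'_def K_def split: split_indicator)
  have u_int: "has_bochner_integral lborel (u n) (ln 2)" for n
    using has_mean_add[OF has_mean_const[of "ln 2"] has_mean_cmult[OF has_mean_ln_circle_inside[OF r[of n]], of "-1"]]
    by (simp add: has_mean_def u_def K_def)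
  have lim: "(\<lambda>n. K (r n) x) \<longlonglongrightarrow> K 1 x" if "x \<in> {0..1}" "x \<notin> {0,1}" for x
    unfolding K_def using nz[OF that] by (auto intro!: tendsto_eq_intros r_lim)
  have ae: "AE x in lborel. x \<notin> {0,1::real}"
    using AE_lborel_singleton[of "0::real"] AE_lborel_singleton[of "1::real"] by eventually_elim auto
  \<comment> \<open>Fatou's lemma for the nonnegative functions \<open>u n\<close>, which all have integral \<open>ln 2\<close>\<close>
  have "integrable lborel u'"
  proof (rule integrableI_bounded)
    have "(\<integral>\<^sup>+ x. ennreal (norm (u' x)) \<partial>lborel) = (\<integral>\<^sup>+ x. liminf (\<lambda>n. ennreal (u n x)) \<partial>lborel)"
    proof (rule nn_integral_cong_AE, use ae in eventually_elim)
      fix x :: real assume x: "x \<notin> {0,1}"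
      have "(\<lambda>n. u n x) \<longlonglongrightarrow> u' x"
        unfolding u_def u'_def using lim[OF _ x] by (auto split: split_indicator intro!: tendsto_intros)
      hence "(\<lambda>n. ennreal (u n x)) \<longlonglongrightarrow> ennreal (u' x)" by (rule tendsto_ennrealI)
      hence "liminf (\<lambda>n. ennreal (u n x)) = ennreal (u' x)"
        by (intro lim_imp_Liminf) auto
      thus "ennreal (norm (u' x)) = liminf (\<lambda>n. ennreal (u n x))" using u'_nonneg[OF x] by simp
    qed
    also have "\<dots> \<le> liminf (\<lambda>n. \<integral>\<^sup>+ x. ennreal (u n x) \<partial>lborel)"
      by (rule nn_integral_liminf) measurable
    also have "(\<lambda>n. \<integral>\<^sup>+ x. ennreal (u n x) \<partial>lborel) = (\<lambda>n. ennreal (ln 2))"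
      using u_int u_nonneg by (auto simp: fun_eq_iff has_bochner_integral_iff nn_integral_eq_integral)
    finally show "(\<integral>\<^sup>+ x. ennreal (norm (u' x)) \<partial>lborel) < \<infinity>"
      by (simp add: Liminf_const le_less_trans)
  qed measurable
  define w where "w = (\<lambda>x. indicator {0..1} x * (2 * ln 2) + u' x)"
  have w: "integrable lborel w"
    unfolding w_def using \<open>integrable lborel u'\<close> has_mean_const[of "2 * ln 2"]
    by (intro Bochner_Integration.integrable_add) (auto simp: has_mean_def has_bochner_integral_iff)
  have "integral\<^sup>L lborel u' = ln 2"
  proof -
    have "(\<lambda>n. integral\<^sup>L lborel (u n)) \<longlonglongrightarrow> integral\<^sup>L lborel u'"
    proof (rule integral_dominated_convergence[OF _ _ w])
      show "AE x in lborel. (\<lambda>n. u n x) \<longlonglongrightarrow> u' x"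
        using ae
      proof eventually_elim
        case (elim x)
        show ?case unfolding u_def u'_def using lim[OF _ elim] by (auto split: split_indicator intro!: tendsto_intros)
      qed
      show "AE x in lborel. norm (u n x) \<le> w x" for n
        using ae
      proof eventually_elim
        case (elim x)
        show ?case
        proof (cases "x \<in> {0..1}")
          case True
          have "ln (cmod (1 - e1 (of_real x))) \<le> ln (2 * cmod (1 - of_real (r n) * e1 (of_real x)))"
            using half[of "r n" x] r[of n] nz[OF True elim] nz'[of n x] by (intro ln_mono) auto
          also have "\<dots> = ln 2 + K (r n) x" using nz'[of n x] by (simp add: K_def ln_mult)
          finally have "ln 2 - K (r n) x \<le> 2 * ln 2 + (ln 2 - K 1 x)"
            using ln_ge_zero[of "2::real"] unfolding K_def of_real_1 mult_1 by linarith
          thus ?thesis using u_nonneg[of n x] True by (simp add: u_def u'_def w_def)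
        qed (simp add: u_def u'_def w_def)
      qed
    qed measurable
    moreover have "integral\<^sup>L lborel (u n) = ln 2" for n
      using u_int[of n] by (simp add: has_bochner_integral_iff)
    ultimately show ?thesis by (simp add: LIMSEQ_const_iff)
  qed
  hence "has_mean (\<lambda>x. ln 2 - K 1 x) (ln 2)"
    using \<open>integrable lborel u'\<close> by (simp add: has_mean_def has_bochner_integral_iff u'_def)
  from has_mean_add[OF has_mean_const[of "ln 2"] has_mean_cmult[OF this, of "-1"]]
  show ?thesis by (simp add: K_def)
qed

lemma has_mean_ln_circle:
  assumes "0 < r" "r \<le> 1"
  shows "has_mean (\<lambda>x. ln (cmod (1 - of_real r * e1 (of_real (x + b))))) 0"
proof (rule has_mean_shift[where f = "\<lambda>x. ln (cmod (1 - of_real r * e1 (of_real x)))"])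
  show "has_mean (\<lambda>x. ln (cmod (1 - of_real r * e1 (of_real x)))) 0"
    using has_mean_ln_circle_inside[of r] has_mean_ln_circle_boundary assms
    by (cases "r = 1") auto
  have "e1 (of_real (x + 1)) = e1 (of_real x)" for x by (subst e1_eq_iff) simp
  thus "ln (cmod (1 - of_real r * e1 (of_real (x + 1)))) = ln (cmod (1 - of_real r * e1 (of_real x)))" for x
    by simp
qed

text \<open>This is where the kinks come from. The mean of \<open>ln |z - w|\<close> over \<open>|z| = R\<close> is
  \<open>max (ln R) (ln |w|)\<close>; here \<open>R = exp (-2\<pi>y)\<close> and \<open>|w| = exp (-2\<pi> Im a)\<close>, so each simple zero
  makes the slope jump by \<open>2\<pi>\<close>.\<close>
lemma has_mean_ln_e1_diff:
  "has_mean (\<lambda>x. ln (cmod (e1 (Complex x y) - e1 a))) (- 2 * pi * y + 2 * pi * max 0 (y - Im a))"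
proof (cases "y \<ge> Im a")
  case True
  define r where "r = exp (- 2 * pi * (y - Im a))"
  have r: "0 < r" "r \<le> 1" using True by (auto simp: r_def)
  have "cmod (e1 (Complex x y) - e1 a) = exp (- 2 * pi * Im a) * cmod (1 - of_real r * e1 (of_real (x + - Re a)))" for x
  proof -
    have "e1 (Complex x y) = e1 a * e1 (\<i> * of_real (y - Im a)) * e1 (of_real (x + - Re a))"
      unfolding e1_add[symmetric] by (rule arg_cong[of _ _ e1]) (simp add: complex_eq_iff)
    also have "e1 (\<i> * of_real (y - Im a)) = of_real r"
      by (simp add: e1_def r_def exp_of_real[symmetric] algebra_simps)
    finally have "e1 (Complex x y) - e1 a = - e1 a * (1 - of_real r * e1 (of_real (x + - Re a)))"
      by (simp add: algebra_simps)
    thus ?thesis by (simp add: norm_mult norm_e1)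
  qed
  note eq = this
  have "has_mean (\<lambda>x. - 2 * pi * Im a + ln (cmod (1 - of_real r * e1 (of_real (x + - Re a))))) (- 2 * pi * Im a + 0)"
    by (intro has_mean_add has_mean_const has_mean_ln_circle r)
  hence "has_mean (\<lambda>x. ln (cmod (e1 (Complex x y) - e1 a))) (- 2 * pi * Im a + 0)"
  proof (rule has_mean_cong_countable[where X = "{x. \<exists>n::int. x = Re a + of_int n}"])
    show "countable {x. \<exists>n::int. x = Re a + of_int n}"
    proof (rule countable_subset)
      show "{x. \<exists>n::int. x = Re a + of_int n} \<subseteq> range (\<lambda>n::int. Re a + of_int n)" by auto
    qed simp
    fix x assume "x \<notin> {x. \<exists>n::int. x = Re a + of_int n}"
    hence "Complex x y - a \<notin> \<int>"
      by (auto elim!: Ints_cases simp: complex_eq_iff) (metis add.commute diff_add_cancel)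
    hence "e1 (Complex x y) \<noteq> e1 a" by (simp add: e1_eq_iff)
    hence "cmod (1 - of_real r * e1 (of_real (x + - Re a))) > 0" using eq[of x] by auto
    thus "- 2 * pi * Im a + ln (cmod (1 - of_real r * e1 (of_real (x + - Re a)))) = ln (cmod (e1 (Complex x y) - e1 a))"
      unfolding eq by (subst ln_mult) auto
  qed
  moreover have "- 2 * pi * Im a + 0 = - 2 * pi * y + 2 * pi * max 0 (y - Im a)"
    using True by (simp add: algebra_simps)
  ultimately show ?thesis by simp
next
  case False
  define r where "r = exp (- 2 * pi * (Im a - y))"
  have r: "0 < r" "r < 1" using False by (auto simp: r_def)
  have "cmod (e1 (Complex x y) - e1 a) = exp (- 2 * pi * y) * cmod (1 - of_real r * e1 (of_real (x + - Re a)))" for x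
  proof -
    have "e1 a = e1 (Complex x y) * e1 (\<i> * of_real (Im a - y)) * e1 (of_real (Re a - x))"
      unfolding e1_add[symmetric] by (rule arg_cong[of _ _ e1]) (simp add: complex_eq_iff)
    also have "e1 (\<i> * of_real (Im a - y)) = of_real r"
      by (simp add: e1_def r_def exp_of_real[symmetric] algebra_simps)
    also have "e1 (of_real (Re a - x)) = cnj (e1 (of_real (x + - Re a)))"
      by (simp add: e1_def exp_cnj algebra_simps)
    finally have "e1 (Complex x y) - e1 a = e1 (Complex x y) * cnj (1 - of_real r * e1 (of_real (x + - Re a)))"
      by (simp add: algebra_simps)
    thus ?thesis by (simp only: norm_mult norm_e1 complex_mod_cnj complex.sel)
  qed
  note eq = this
  have "cmod (1 - of_real r * e1 (of_real (x + - Re a))) > 0" for x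
  proof -
    have "cmod (of_real r * e1 (of_real (x + - Re a))) < 1" using r by (simp add: norm_mult norm_e1)
    thus ?thesis by auto
  qed
  hence "ln (cmod (e1 (Complex x y) - e1 a)) = - 2 * pi * y + ln (cmod (1 - of_real r * e1 (of_real (x + - Re a))))" for x
    unfolding eq by (subst ln_mult) auto
  moreover have "has_mean (\<lambda>x. - 2 * pi * y + ln (cmod (1 - of_real r * e1 (of_real (x + - Re a))))) (- 2 * pi * y + 0)"
    by (intro has_mean_add has_mean_const has_mean_ln_circle) (use r in auto)
  ultimately show ?thesis using False by simp
qed

section \<open>Logarithmic means of periodic holomorphic functions\<close>

definition strip :: "real \<Rightarrow> real \<Rightarrow> complex set"
  where "strip h \<delta> = {t. \<bar>Im t - h\<bar> < \<delta>}"

lemma open_strip: "open (strip h \<delta>)"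
  unfolding strip_def by (intro open_Collect_less continuous_intros)

lemma convex_strip: "convex (strip h \<delta>)"
proof -
  have "strip h \<delta> = {t. Im t < h + \<delta>} \<inter> {t. Im t > h - \<delta>}" by (auto simp: strip_def)
  thus ?thesis by (simp add: convex_Int convex_halfspace_Im_lt convex_halfspace_Im_gt)
qed

lemma strip_shift [simp]: "t + of_real x \<in> strip h \<delta> \<longleftrightarrow> t \<in> strip h \<delta>" "t + 1 \<in> strip h \<delta> \<longleftrightarrow> t \<in> strip h \<delta>"
    "t + of_int n \<in> strip h \<delta> \<longleftrightarrow> t \<in> strip h \<delta>"
  by (auto simp: strip_def)

lemma periodic_of_int:
  fixes f :: "complex \<Rightarrow> 'a"
  assumes "\<And>t. t \<in> strip h \<delta> \<Longrightarrow> f (t + 1) = f t" "t \<in> strip h \<delta>"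
  shows "f (t + of_int n) = f t"
proof (induction n rule: int_induct[where k = 0])
  case (step1 i) thus ?case using assms(1)[of "t + of_int i"] assms(2) by (simp add: add.assoc)
next
  case (step2 i)
  have "t + of_int (i - 1) \<in> strip h \<delta>" using assms(2) by (simp only: strip_shift)
  from assms(1)[OF this] show ?case using step2 by (simp add: add.assoc)
qed simp

text \<open>If \<open>R\<close> is a primitive of \<open>P\<close>, then the integral of \<open>P\<close> over a period is \<open>R (t + 1) - R t\<close>, whose
  derivative \<open>P (t + 1) - P t\<close> vanishes.\<close>
lemma mean_periodic_holomorphic:
  assumes P: "P holomorphic_on strip h \<delta>" and per: "\<And>t. t \<in> strip h \<delta> \<Longrightarrow> P (t + 1) = P t"
  obtains c where "\<And>y. \<bar>y - h\<bar> < \<delta> \<Longrightarrow> has_mean (\<lambda>x. Re (P (Complex x y))) c"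
proof -
  obtain R where R: "\<And>t. t \<in> strip h \<delta> \<Longrightarrow> (R has_field_derivative P t) (at t within strip h \<delta>)"
    using holomorphic_convex_primitive'[OF convex_strip open_strip P] by blast
  have R': "(R has_field_derivative P t) (at t)" if "t \<in> strip h \<delta>" for t
    using R[OF that] at_within_open[OF that open_strip] by simp
  have "((\<lambda>t. R (t + 1) - R t) has_field_derivative 0) (at t within strip h \<delta>)" if t: "t \<in> strip h \<delta>" for t
  proof -
    have "((\<lambda>t. R (t + 1)) has_field_derivative P (t + 1)) (at t)"
      using R'[of "t + 1"] t by (simp add: DERIV_shift)
    from DERIV_diff[OF this R'[OF t]] have "((\<lambda>t. R (t + 1) - R t) has_field_derivative 0) (at t)"
      by (simp add: per[OF t])
    thus ?thesis by (rule has_field_derivative_at_within)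
  qed
  from has_field_derivative_zero_constant[OF convex_strip this]
  obtain c where c: "\<And>t. t \<in> strip h \<delta> \<Longrightarrow> R (t + 1) - R t = c"
    by blast
  show ?thesis
  proof
    fix y assume y: "\<bar>y - h\<bar> < \<delta>"
    have str: "Complex x y \<in> strip h \<delta>" for x using y by (simp add: strip_def)
    have "((\<lambda>x. P (Complex x y)) has_integral (R (Complex 1 y) - R (Complex 0 y))) {0..1}"
    proof (rule fundamental_theorem_of_calculus)
      fix x :: real
      have "((\<lambda>x. of_real x + \<i> * of_real y) has_vector_derivative 1) (at x)"
        by (auto intro!: derivative_eq_intros)
      moreover have "(\<lambda>x. of_real x + \<i> * of_real y) = (\<lambda>x. Complex x y)"
        by (simp add: fun_eq_iff complex_eq_iff)
      ultimately have "((\<lambda>x. Complex x y) has_vector_derivative 1) (at x)" by simp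
      from field_vector_diff_chain_at[OF this R'[OF str]]
      show "((\<lambda>x. R (Complex x y)) has_vector_derivative P (Complex x y)) (at x within {0..1})"
        by (auto simp: o_def intro: has_vector_derivative_at_within)
    qed simp
    also have "R (Complex 1 y) - R (Complex 0 y) = c"
    proof -
      have "Complex 0 y + 1 = Complex 1 y" by (simp add: complex_eq_iff)
      thus ?thesis using c[OF str[of 0]] by simp
    qed
    finally have int: "((\<lambda>x. P (Complex x y)) has_integral c) {0..1}" .
    have "continuous_on {0..1} (\<lambda>x. P (Complex x y))"
      by (rule continuous_on_compose2[OF holomorphic_on_imp_continuous_on[OF P]])
         (use str in \<open>auto simp: complex_eq intro!: continuous_intros\<close>)
    from has_mean_continuous_complex[OF this int]
    show "has_mean (\<lambda>x. Re (P (Complex x y))) (Re c)" .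
  qed
qed

text \<open>Write \<open>g = exp G\<close>. Periodicity of \<open>g\<close> makes \<open>G (t + 1) - G t\<close> a constant \<open>c\<close>, and \<open>c\<close> is purely
  imaginary as \<open>exp c = 1\<close>. Then \<open>G t - c t\<close> is periodic, so the mean of its real part is constant,
  and the correction \<open>Re (c t)\<close> is linear in \<open>Im t\<close>.\<close>
lemma mean_ln_nonvanishing:
  assumes g: "g holomorphic_on strip h \<delta>" and per: "\<And>t. t \<in> strip h \<delta> \<Longrightarrow> g (t + 1) = g t"
    and nz: "\<And>t. t \<in> strip h \<delta> \<Longrightarrow> g t \<noteq> 0" and "\<delta> > 0"
  obtains A B where "\<And>y. \<bar>y - h\<bar> < \<delta> \<Longrightarrow> has_mean (\<lambda>x. ln (cmod (g (Complex x y)))) (A + B * y)"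
proof -
  obtain G where G: "G holomorphic_on strip h \<delta>" "\<And>t. t \<in> strip h \<delta> \<Longrightarrow> g t = exp (G t)"
    using contractible_imp_holomorphic_log[OF g convex_imp_contractible[OF convex_strip] nz] by blast
  have dg: "(g has_field_derivative deriv G t * g t) (at t)" if t: "t \<in> strip h \<delta>" for t
  proof (rule has_field_derivative_transform_within_open[OF _ open_strip t])
    show "((\<lambda>t. exp (G t)) has_field_derivative deriv G t * g t) (at t)"
      using holomorphic_derivI[OF G(1) open_strip t] G(2)[OF t] by (auto intro!: derivative_eq_intros)
  qed (simp add: G)
  have dG: "deriv G (t + 1) = deriv G t" if t: "t \<in> strip h \<delta>" for t
  proof -
    have "((\<lambda>t. g (t + 1)) has_field_derivative deriv G (t + 1) * g (t + 1)) (at t)"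
      using dg[of "t + 1"] t by (simp add: DERIV_shift)
    hence "(g has_field_derivative deriv G (t + 1) * g (t + 1)) (at t)"
      by (rule has_field_derivative_transform_within_open[OF _ open_strip t]) (simp add: per)
    from DERIV_unique[OF this dg[OF t]] show ?thesis using per[OF t] nz[OF t] by simp
  qed
  have "((\<lambda>t. G (t + 1) - G t) has_field_derivative 0) (at t within strip h \<delta>)" if t: "t \<in> strip h \<delta>" for t
  proof -
    have "(G has_field_derivative deriv G (t + 1)) (at (t + 1))"
      using holomorphic_derivI[OF G(1) open_strip, of "t + 1"] t by simp
    hence "((\<lambda>t. G (t + 1)) has_field_derivative deriv G (t + 1)) (at t)"
      by (simp only: DERIV_shift)
    from DERIV_diff[OF this holomorphic_derivI[OF G(1) open_strip t]]
    have "((\<lambda>t. G (t + 1) - G t) has_field_derivative 0) (at t)" by (simp add: dG[OF t])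
    thus ?thesis by (rule has_field_derivative_at_within)
  qed
  from has_field_derivative_zero_constant[OF convex_strip this]
  obtain c where c: "\<And>t. t \<in> strip h \<delta> \<Longrightarrow> G (t + 1) - G t = c"
    by blast
  have "Re c = 0"
  proof -
    define t where "t = Complex 0 h"
    have t: "t \<in> strip h \<delta>" using \<open>\<delta> > 0\<close> by (simp add: t_def strip_def)
    have "exp (G (t + 1)) = exp (G t)" using per[OF t] G(2)[of t] G(2)[of "t + 1"] t by simp
    hence "exp c = 1" using c[OF t, symmetric] by (simp add: exp_diff)
    hence "cmod (exp c) = 1" by simp
    thus ?thesis by simp
  qed
  have "(\<lambda>t. G t - c * t) holomorphic_on strip h \<delta>" by (intro holomorphic_intros G)
  moreover have "G (t + 1) - c * (t + 1) = G t - c * t" if "t \<in> strip h \<delta>" for t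
    using c[OF that] by (simp add: algebra_simps)
  ultimately obtain A where A: "\<And>y. \<bar>y - h\<bar> < \<delta> \<Longrightarrow>
      has_mean (\<lambda>x. Re (G (Complex x y) - c * Complex x y)) A"
    using mean_periodic_holomorphic[of "\<lambda>t. G t - c * t" h \<delta>] by blast
  show ?thesis
  proof (rule that[of A "- Im c"])
    fix y assume y: "\<bar>y - h\<bar> < \<delta>"
    have "Re (G (Complex x y) - c * Complex x y) + - Im c * y = ln (cmod (g (Complex x y)))" for x
      using G(2)[of "Complex x y"] y \<open>Re c = 0\<close> by (simp add: strip_def)
    thus "has_mean (\<lambda>x. ln (cmod (g (Complex x y)))) (A + - Im c * y)"
      using has_mean_add[OF A[OF y] has_mean_const[of "- Im c * y"]] by simp
  qed
qed

lemma zorder_e1_diff: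
  "zorder (\<lambda>s. e1 s - e1 a) t = (if e1 t = e1 a then 1 else 0)"
proof (cases "e1 t = e1 a")
  case True
  have d: "((\<lambda>s. e1 s - e1 a) has_field_derivative (2 * of_real pi * \<i> * e1 t)) (at t)"
    unfolding e1_def by (auto intro!: derivative_eq_intros)
  have "zorder (\<lambda>s. e1 s - e1 a) t = 1"
  proof (rule zorder_zero_eqI[of _ UNIV])
    show "(\<lambda>s. e1 s - e1 a) holomorphic_on UNIV" by (intro holomorphic_intros)
    show "(deriv ^^ i) (\<lambda>s. e1 s - e1 a) t = 0" if "i < nat 1" for i using that True by simp
    show "(deriv ^^ nat 1) (\<lambda>s. e1 s - e1 a) t \<noteq> 0" using DERIV_imp_deriv[OF d] by simp
  qed auto
  thus ?thesis using True by simp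
next
  case False
  have "zorder (\<lambda>s. e1 s - e1 a) t = 0"
  proof (rule zorder_eq_0I)
    show "(\<lambda>s. e1 s - e1 a) analytic_on {t}"
      by (rule holomorphic_on_imp_analytic_at[of _ UNIV]) (auto intro!: holomorphic_intros)
  qed (use False in auto)
  thus ?thesis using False by simp
qed

lemma eventually_e1_diff_nonzero: "eventually (\<lambda>s. e1 s - e1 a \<noteq> 0) (at t)"
proof (cases "e1 t = e1 a")
  case True
  have "(\<lambda>s. e1 s - e1 a) holomorphic_on UNIV" by (intro holomorphic_intros)
  \<comment> \<open>half a period away from \<open>a\<close> the function does not vanish, so its zeros are isolated\<close>
  moreover have "e1 (a + of_real (1/2)) - e1 a \<noteq> 0"
  proof -
    have "of_real (1/2) \<notin> (\<int> :: complex set)"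
      unfolding of_real_in_Ints_iff by (auto elim!: Ints_cases)
    thus ?thesis by (simp add: e1_eq_iff)
  qed
  ultimately obtain r where "0 < r" "\<And>z. z \<in> ball t r - {t} \<Longrightarrow> e1 z - e1 a \<noteq> 0"
    using isolated_zeros[of "\<lambda>s. e1 s - e1 a" UNIV t "a + of_real (1/2)"] True by auto
  thus ?thesis unfolding eventually_at by (intro exI[of _ r]) (auto simp: dist_commute)
next
  case False
  have "isCont (\<lambda>s. e1 s - e1 a) t" unfolding e1_def by (intro continuous_intros)
  hence "((\<lambda>s. e1 s - e1 a) \<longlongrightarrow> e1 t - e1 a) (at t)" by (simp add: isCont_def)
  thus ?thesis using False by (intro tendsto_imp_eventually_ne) auto
qed

text \<open>A smaller closed strip is compact modulo \<open>\<int>\<close>, so it contains finitely many zeros modulo \<open>\<int>\<close>; shrinking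
  it further excludes those that are not on the circle.\<close>
lemma periodic_zero_set_local:
  assumes D: "D holomorphic_on strip h \<epsilon>" and per: "\<And>t. t \<in> strip h \<epsilon> \<Longrightarrow> D (t + 1) = D t"
    and "\<epsilon> > 0" and nz: "t0 \<in> strip h \<epsilon>" "D t0 \<noteq> 0"
  obtains \<delta> where "0 < \<delta>" "\<delta> \<le> \<epsilon>" "finite (circle_zeros D h)"
    "\<And>t. 0 < \<bar>Im t - h\<bar> \<Longrightarrow> \<bar>Im t - h\<bar> < \<delta> \<Longrightarrow> D t \<noteq> 0"
proof -
  define K where "K = cbox (Complex 0 (h - \<epsilon>/2)) (Complex 1 (h + \<epsilon>/2))"
  have K: "t \<in> K \<longleftrightarrow> 0 \<le> Re t \<and> Re t \<le> 1 \<and> \<bar>Im t - h\<bar> \<le> \<epsilon>/2" for t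
    unfolding K_def in_cbox_complex_iff complex.sel abs_le_iff atLeastAtMost_iff by linarith
  have sub: "K \<subseteq> strip h \<epsilon>" using \<open>\<epsilon> > 0\<close> by (auto simp: K strip_def)
  have fin: "finite {t \<in> K. D t = 0}"
  proof (cases "D constant_on strip h \<epsilon>")
    case True
    hence "D t \<noteq> 0" if "t \<in> K" for t
      using that sub nz unfolding constant_on_def by (metis subsetD)
    hence "{t \<in> K. D t = 0} = {}" by blast
    thus ?thesis by (simp only: finite.emptyI)
  next
    case False
    have "compact K" unfolding K_def by (rule compact_cbox)
    from holomorphic_compact_finite_zeros[OF D open_strip convex_connected[OF convex_strip] this sub False]
    show ?thesis .
  qed
  have "circle_zeros D h \<subseteq> {t \<in> K. D t = 0}"
    using \<open>\<epsilon> > 0\<close> by (auto simp: circle_zeros_def K)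
  hence fin_Z: "finite (circle_zeros D h)" using fin finite_subset by blast
  define N where "N = (\<lambda>t. \<bar>Im t - h\<bar>) ` {t \<in> K. D t = 0 \<and> Im t \<noteq> h}"
  have fin_N: "finite (insert (\<epsilon>/2) N)"
    unfolding N_def by (intro finite.insertI finite_imageI finite_subset[OF _ fin]) auto
  define \<delta> where "\<delta> = Min (insert (\<epsilon>/2) N)"
  have "\<delta> \<in> insert (\<epsilon>/2) N" unfolding \<delta>_def by (rule Min_in[OF fin_N]) simp
  hence "0 < \<delta>" using \<open>\<epsilon> > 0\<close> by (auto simp: N_def)
  have \<delta>_le: "\<delta> \<le> n" if "n \<in> insert (\<epsilon>/2) N" for n
    unfolding \<delta>_def by (rule Min_le[OF fin_N that])
  have "D t \<noteq> 0" if t: "0 < \<bar>Im t - h\<bar>" "\<bar>Im t - h\<bar> < \<delta>" for t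
  proof
    assume "D t = 0"
    define t' where "t' = t + of_int (- \<lfloor>Re t\<rfloor>)"
    have "t \<in> strip h \<epsilon>" using t \<delta>_le[of "\<epsilon>/2"] \<open>\<epsilon> > 0\<close> by (simp add: strip_def)
    hence "D t' = 0" using periodic_of_int[where f = D, OF per] \<open>D t = 0\<close> by (simp only: t'_def)
    moreover have "t' \<in> K"
      using t \<delta>_le[of "\<epsilon>/2"] by (simp add: K t'_def) linarith
    moreover have "Im t' = Im t" by (simp add: t'_def)
    ultimately have "\<bar>Im t - h\<bar> \<in> N" using t unfolding N_def by (intro image_eqI[of _ _ t']) auto
    thus False using \<delta>_le[of "\<bar>Im t - h\<bar>"] t by simp
  qed
  moreover have "\<delta> \<le> \<epsilon>" using \<delta>_le[of "\<epsilon>/2"] \<open>\<epsilon> > 0\<close> by simp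
  ultimately show ?thesis using that fin_Z \<open>0 < \<delta>\<close> by blast
qed

lemma eventually_nonzero_strip:
  assumes D: "D holomorphic_on strip h \<epsilon>"
    and nz: "t0 \<in> strip h \<epsilon>" "D t0 \<noteq> 0" and t: "t \<in> strip h \<epsilon>"
  shows "eventually (\<lambda>s. D s \<noteq> 0) (at t)"
proof (cases "D t = 0")
  case True
  obtain r where "0 < r" "\<And>z. z \<in> ball t r - {t} \<Longrightarrow> D z \<noteq> 0"
    using isolated_zeros[OF D open_strip convex_connected[OF convex_strip] t True nz] by metis
  thus ?thesis unfolding eventually_at by (intro exI[of _ r]) (auto simp: dist_commute)
next
  case False
  have "isCont D t" using holomorphic_on_imp_continuous_on[OF D] open_strip t
    by (simp add: continuous_on_eq_continuous_at)
  hence "(D \<longlongrightarrow> D t) (at t)" by (simp add: isCont_def)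
  thus ?thesis using False by (intro tendsto_imp_eventually_ne) auto
qed

lemma zorder_periodic:
  assumes per: "\<And>t. t \<in> strip h \<epsilon> \<Longrightarrow> D (t + 1) = D t" and t: "t \<in> strip h \<epsilon>"
  shows "zorder D (t + of_int n) = zorder D t"
proof -
  have "eventually (\<lambda>u. u + t \<in> strip h \<epsilon>) (at 0)"
  proof -
    have "open ((\<lambda>u. u + t) -` strip h \<epsilon>)"
      by (intro open_vimage open_strip continuous_intros)
    hence "eventually (\<lambda>u. u \<in> (\<lambda>u. u + t) -` strip h \<epsilon>) (nhds 0)"
      by (rule eventually_nhds_in_open) (use t in simp)
    thus ?thesis by (auto simp: eventually_at_filter elim: eventually_mono)
  qed
  hence "eventually (\<lambda>u. D (u + (t + of_int n)) = D (u + t)) (at 0)"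
  proof eventually_elim
    case (elim u)
    from periodic_of_int[where f = D, OF per elim, of n] show ?case by (simp add: add.assoc)
  qed
  hence "zorder (\<lambda>u. D (u + (t + of_int n))) 0 = zorder (\<lambda>u. D (u + t)) 0"
    by (rule zorder_cong) simp
  thus ?thesis using zorder_shift[of D t] zorder_shift[of D "t + of_int n"] by simp
qed

definition zero_product :: "(complex \<Rightarrow> nat) \<Rightarrow> complex set \<Rightarrow> complex \<Rightarrow> complex"
  where "zero_product m Z t = (\<Prod>a\<in>Z. (e1 t - e1 a) ^ m a)"

lemma zero_product_holomorphic: "zero_product m Z holomorphic_on UNIV"
  unfolding zero_product_def by (intro holomorphic_intros)

lemma eventually_zero_product_nonzero:
  assumes "finite Z"
  shows "eventually (\<lambda>s. zero_product m Z s \<noteq> 0) (at t)"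
proof -
  have "eventually (\<lambda>s. \<forall>a\<in>Z. e1 s - e1 a \<noteq> 0) (at t)"
    by (intro eventually_ball_finite assms ballI eventually_e1_diff_nonzero)
  thus ?thesis by eventually_elim (use assms in \<open>auto simp: zero_product_def\<close>)
qed

lemma zorder_zero_product:
  assumes "finite Z"
  shows "zorder (zero_product m Z) t = (\<Sum>a\<in>Z. if e1 t = e1 a then int (m a) else 0)"
proof -
  have mero: "(\<lambda>s. e1 s - e1 a) meromorphic_on {t}" for a
    by (intro analytic_on_imp_meromorphic_on holomorphic_on_imp_analytic_at[of _ UNIV]) (auto intro!: holomorphic_intros)
  have freq: "frequently (\<lambda>s. e1 s - e1 a \<noteq> 0) (at t)" for a
    by (rule eventually_frequently[OF _ eventually_e1_diff_nonzero]) simp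
  have "zorder (\<lambda>s. \<Prod>a\<in>Z. (e1 s - e1 a) ^ m a) t = (\<Sum>a\<in>Z. zorder (\<lambda>s. (e1 s - e1 a) ^ m a) t)"
    using eventually_zero_product_nonzero[OF assms, of m t]
    by (intro zorder_prod) (auto intro!: meromorphic_intros mero simp: zero_product_def)
  also have "\<dots> = (\<Sum>a\<in>Z. if e1 t = e1 a then int (m a) else 0)"
    by (intro sum.cong refl) (simp add: zorder_power[OF mero freq] zorder_e1_diff)
  finally show ?thesis unfolding zero_product_def .
qed

text \<open>The quotient \<open>D / Q\<close> has order zero everywhere on the strip, so removing its singularities leaves
  a holomorphic function without zeros.\<close>
lemma periodic_factorization:
  assumes D: "D holomorphic_on strip h \<epsilon>" and per: "\<And>t. t \<in> strip h \<epsilon> \<Longrightarrow> D (t + 1) = D t"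
    and nz: "t0 \<in> strip h \<epsilon>" "D t0 \<noteq> 0" and \<delta>: "0 < \<delta>" "\<delta> \<le> \<epsilon>" and Z: "finite (circle_zeros D h)"
    and off: "\<And>t. 0 < \<bar>Im t - h\<bar> \<Longrightarrow> \<bar>Im t - h\<bar> < \<delta> \<Longrightarrow> D t \<noteq> 0"
  defines "Q \<equiv> zero_product (\<lambda>a. nat (zorder D a)) (circle_zeros D h)"
  obtains g where "g holomorphic_on strip h \<delta>" "\<And>t. t \<in> strip h \<delta> \<Longrightarrow> g (t + 1) = g t"
    "\<And>t. t \<in> strip h \<delta> \<Longrightarrow> g t \<noteq> 0" "\<And>t. t \<in> strip h \<delta> \<Longrightarrow> D t = Q t * g t"
proof -
  define m where "m = (\<lambda>a. nat (zorder D a))"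
  have sub: "strip h \<delta> \<subseteq> strip h \<epsilon>" using \<delta> by (auto simp: strip_def)
  have ana_D: "D analytic_on {t}" if "t \<in> strip h \<epsilon>" for t
    using D open_strip that by (rule holomorphic_on_imp_analytic_at)
  have ana_Q: "Q analytic_on {t}" for t
    unfolding Q_def by (rule holomorphic_on_imp_analytic_at[OF zero_product_holomorphic]) auto
  have ev_D: "eventually (\<lambda>s. D s \<noteq> 0) (at t)" if "t \<in> strip h \<epsilon>" for t
    by (rule eventually_nonzero_strip[OF D nz that])
  have ev_Q: "eventually (\<lambda>s. Q s \<noteq> 0) (at t)" for t
    unfolding Q_def by (rule eventually_zero_product_nonzero[OF Z])
  have fr_D: "frequently (\<lambda>s. D s \<noteq> 0) (at t)" if "t \<in> strip h \<epsilon>" for t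
    by (rule eventually_frequently[OF _ ev_D[OF that]]) simp
  have fr_Q: "frequently (\<lambda>s. Q s \<noteq> 0) (at t)" for t
    by (rule eventually_frequently[OF _ ev_Q]) simp
  have ord: "zorder D t = zorder Q t" if t: "t \<in> strip h \<delta>" for t
  proof -
    have t': "t \<in> strip h \<epsilon>" using t sub by blast
    have Q: "zorder Q t = (\<Sum>a\<in>circle_zeros D h. if e1 t = e1 a then int (m a) else 0)"
      unfolding Q_def m_def by (rule zorder_zero_product[OF Z])
    show ?thesis
    proof (cases "D t = 0")
      case False
      have "e1 t \<noteq> e1 a" if a: "a \<in> circle_zeros D h" for a
      proof
        assume "e1 t = e1 a"
        then obtain n where "t - a = of_int n" by (auto simp: e1_eq_iff elim: Ints_cases)
        hence n: "t = a + of_int n" by (simp add: algebra_simps)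
        have "a \<in> strip h \<epsilon>" using t' by (simp add: n)
        from periodic_of_int[where f = D, OF per this, of n] have "D t = D a" by (simp add: n)
        thus False using a False by (simp add: circle_zeros_def)
      qed
      hence "zorder Q t = 0" unfolding Q by (intro sum.neutral) auto
      moreover have "zorder D t = 0" using zorder_eq_0I[OF ana_D[OF t'] False] .
      ultimately show ?thesis by simp
    next
      case True
      \<comment> \<open>the only zero in the fundamental domain whose factor vanishes at \<open>t\<close>\<close>
      define a0 where "a0 = t + of_int (- \<lfloor>Re t\<rfloor>)"
      have "Im t = h" using off[of t] t True by (auto simp: strip_def)
      moreover have "D a0 = 0"
        unfolding a0_def using periodic_of_int[where f = D, OF per t', of "- \<lfloor>Re t\<rfloor>"] True by simp
      moreover have "0 \<le> Re a0 \<and> Re a0 < 1" by (simp add: a0_def) linarith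
      ultimately have a0: "a0 \<in> circle_zeros D h" by (auto simp: circle_zeros_def a0_def)
      have ord0: "zorder D a0 = zorder D t"
        unfolding a0_def by (rule zorder_periodic[where D = D, OF per t'])
      have eq: "e1 t = e1 a \<longleftrightarrow> a = a0" if a: "a \<in> circle_zeros D h" for a
      proof
        assume "e1 t = e1 a"
        then obtain n where "t - a = of_int n" by (auto simp: e1_eq_iff elim: Ints_cases)
        hence "a0 - a = of_int (n - \<lfloor>Re t\<rfloor>)" by (simp add: a0_def)
        moreover from this have "Re a0 - Re a = of_int (n - \<lfloor>Re t\<rfloor>)"
          by (metis minus_complex.sel(1) Re_complex_of_real of_real_of_int_eq)
        hence "\<bar>real_of_int (n - \<lfloor>Re t\<rfloor>)\<bar> < 1"
          using a a0 by (auto simp: circle_zeros_def abs_less_iff)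
        hence "n - \<lfloor>Re t\<rfloor> = 0" by linarith
        ultimately show "a = a0" by simp
      qed (auto simp: e1_eq_iff a0_def)
      have "zorder Q t = (\<Sum>a\<in>circle_zeros D h. if a = a0 then int (m a) else 0)"
        unfolding Q using eq by (intro sum.cong) auto
      also have "\<dots> = int (m a0)" using Z a0 by simp
      also have "\<dots> = zorder D t"
        using zorder_ge_0[OF ana_D[OF t'] fr_D[OF t']] ord0 by (simp add: m_def)
      finally show ?thesis by simp
    qed
  qed
  define f where "f = (\<lambda>s. D s / Q s)"
  have loc: "\<exists>c. c \<noteq> 0 \<and> remove_sings f t = c \<and> remove_sings f analytic_on {t} \<and> D t = Q t * c"
    if t: "t \<in> strip h \<delta>" for t
  proof -
    have t': "t \<in> strip h \<epsilon>" using t sub by blast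
    have mero: "D meromorphic_on {t}" "Q meromorphic_on {t}"
      using ana_D[OF t'] ana_Q by (auto intro: analytic_on_imp_meromorphic_on)
    have mero_f: "f meromorphic_on {t}" unfolding f_def by (intro meromorphic_intros mero)
    hence sing: "isolated_singularity_at f t" "not_essential f t" by (auto simp: meromorphic_at_iff)
    have "eventually (\<lambda>s. f s \<noteq> 0) (at t)"
      using ev_D[OF t'] ev_Q by eventually_elim (simp add: f_def)
    hence fr_f: "frequently (\<lambda>s. f s \<noteq> 0) (at t)" by (rule eventually_frequently[rotated]) simp
    have "zorder f t = 0"
      unfolding f_def using zorder_divide[OF mero(1) fr_D[OF t'] mero(2) fr_Q] ord[OF t] by simp
    with zorder_exist[OF sing fr_f] obtain r where r: "r > 0" "zor_poly f t t \<noteq> 0"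
        "zor_poly f t holomorphic_on cball t r" "\<And>w. w \<in> cball t r - {t} \<Longrightarrow> f w = zor_poly f t w"
      by auto
    define c where "c = zor_poly f t t"
    have "continuous_on (ball t r) (zor_poly f t)"
      using r(3) by (intro holomorphic_on_imp_continuous_on) (auto intro: holomorphic_on_subset)
    hence "isCont (zor_poly f t) t" using r(1) by (simp add: continuous_on_eq_continuous_at)
    hence "zor_poly f t \<midarrow>t\<rightarrow> c" by (simp add: isCont_def c_def)
    moreover have ev: "eventually (\<lambda>w. zor_poly f t w = f w) (at t)"
      unfolding eventually_at using r(1,4) by (intro exI[of _ r]) (auto simp: dist_commute)
    ultimately have lim: "f \<midarrow>t\<rightarrow> c" by (rule Lim_transform_eventually)
    have "(\<lambda>s. Q s * f s) \<midarrow>t\<rightarrow> Q t * c"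
      using analytic_at_imp_isCont[OF ana_Q] lim by (auto intro!: tendsto_intros simp: isCont_def)
    moreover have "eventually (\<lambda>s. Q s * f s = D s) (at t)"
      using ev_Q by eventually_elim (simp add: f_def)
    ultimately have "D \<midarrow>t\<rightarrow> Q t * c" by (rule Lim_transform_eventually)
    moreover have "D \<midarrow>t\<rightarrow> D t" using analytic_at_imp_isCont[OF ana_D[OF t']] by (simp add: isCont_def)
    ultimately have "D t = Q t * c" by (intro tendsto_unique[OF _ _ \<open>D \<midarrow>t\<rightarrow> Q t * c\<close>]) auto
    thus ?thesis
      using r(2) remove_sings_eqI[OF lim] remove_sings_analytic_at[OF sing(1) lim] by (auto simp: c_def)
  qed
  show ?thesis
  proof (rule that[of "remove_sings f"])
    show "remove_sings f holomorphic_on strip h \<delta>"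
      using loc analytic_on_analytic_at[of "remove_sings f" "strip h \<delta>"] analytic_imp_holomorphic by blast
    show "remove_sings f t \<noteq> 0" "D t = Q t * remove_sings f t" if "t \<in> strip h \<delta>" for t
      using loc[OF that] by auto
    show "remove_sings f (t + 1) = remove_sings f t" if t: "t \<in> strip h \<delta>" for t
    proof -
      have f_per: "f (s + 1) = f s" if "s \<in> strip h \<epsilon>" for s
      proof -
        have "e1 (s + 1) = e1 s" by (simp add: e1_eq_iff)
        thus ?thesis using per[OF that] by (simp add: f_def Q_def zero_product_def)
      qed
      have "open ((\<lambda>w. t + w) -` strip h \<epsilon>)"
        by (intro open_vimage open_strip continuous_intros)
      hence "eventually (\<lambda>w. w \<in> (\<lambda>w. t + w) -` strip h \<epsilon>) (nhds 0)"
        by (rule eventually_nhds_in_open) (use t sub in auto)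
      hence "eventually (\<lambda>w. t + w \<in> strip h \<epsilon>) (at 0)"
        by (auto simp: eventually_at_filter elim: eventually_mono)
      hence "eventually (\<lambda>w. f (t + 1 + w) = f (t + w)) (at 0)"
      proof eventually_elim
        case (elim w)
        from f_per[OF elim] show ?case by (simp add: add_ac)
      qed
      from remove_sings_cong[OF this refl] show ?thesis
        using remove_sings_shift_0[of f "t + 1"] remove_sings_shift_0[of f t] by simp
    qed
  qed
qed

text \<open>Take logarithms in the factorization: the factor without zeros contributes an affine function of
  the height, and a zero of order \<open>m\<close> contributes \<open>m\<close> kinks at height \<open>h\<close>.\<close>
lemma mean_ln_local_form:
  assumes D: "D holomorphic_on strip h \<epsilon>" and per: "\<And>t. t \<in> strip h \<epsilon> \<Longrightarrow> D (t + 1) = D t"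
    and "\<epsilon> > 0" and nz: "t0 \<in> strip h \<epsilon>" "D t0 \<noteq> 0"
  obtains \<delta> A B where "0 < \<delta>" "\<delta> \<le> \<epsilon>" "finite (circle_zeros D h)"
    "\<And>a. a \<in> circle_zeros D h \<Longrightarrow> zorder D a > 0"
    "\<And>t. 0 < \<bar>Im t - h\<bar> \<Longrightarrow> \<bar>Im t - h\<bar> < \<delta> \<Longrightarrow> D t \<noteq> 0"
    "\<And>y. \<bar>y - h\<bar> < \<delta> \<Longrightarrow> has_mean (\<lambda>x. ln (cmod (D (Complex x y))))
      (A + B * y + 2 * pi * of_int (\<Sum>a\<in>circle_zeros D h. zorder D a) * max 0 (y - h))"
proof -
  define Z where "Z = circle_zeros D h"
  obtain \<delta> where \<delta>: "0 < \<delta>" "\<delta> \<le> \<epsilon>" and Z: "finite (circle_zeros D h)"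
    and off: "\<And>t. 0 < \<bar>Im t - h\<bar> \<Longrightarrow> \<bar>Im t - h\<bar> < \<delta> \<Longrightarrow> D t \<noteq> 0"
    using periodic_zero_set_local[OF D per \<open>\<epsilon> > 0\<close> nz] by metis
  have pos: "zorder D a > 0" if "a \<in> Z" for a
  proof -
    have a: "a \<in> strip h \<epsilon>" "D a = 0" using that \<open>\<epsilon> > 0\<close> by (auto simp: Z_def circle_zeros_def strip_def)
    have "frequently (\<lambda>s. D s \<noteq> 0) (at a)"
      by (rule eventually_frequently[OF _ eventually_nonzero_strip[OF D nz a(1)]]) simp
    thus ?thesis using zorder_pos_iff[OF D open_strip a(1)] a(2) by blast
  qed
  define m where "m = (\<lambda>a. nat (zorder D a))"
  obtain g where g: "g holomorphic_on strip h \<delta>" "\<And>t. t \<in> strip h \<delta> \<Longrightarrow> g (t + 1) = g t"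
      "\<And>t. t \<in> strip h \<delta> \<Longrightarrow> g t \<noteq> 0"
      "\<And>t. t \<in> strip h \<delta> \<Longrightarrow> D t = zero_product m Z t * g t"
    unfolding m_def Z_def using periodic_factorization[OF D per nz \<delta> Z off] by metis
  obtain A B where AB: "\<And>y. \<bar>y - h\<bar> < \<delta> \<Longrightarrow> has_mean (\<lambda>x. ln (cmod (g (Complex x y)))) (A + B * y)"
    using mean_ln_nonvanishing[OF g(1-3) \<open>0 < \<delta>\<close>] by metis
  define n where "n = (\<Sum>a\<in>Z. real (m a))"
  have n: "n = of_int (\<Sum>a\<in>Z. zorder D a)"
    unfolding n_def m_def of_int_sum using pos by (intro sum.cong refl) (simp add: less_imp_le)
  have mean: "has_mean (\<lambda>x. ln (cmod (D (Complex x y))))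
      (A + (B - 2 * pi * n) * y + 2 * pi * n * max 0 (y - h))" if y: "\<bar>y - h\<bar> < \<delta>" for y
  proof -
    have "has_mean (\<lambda>x. ln (cmod (g (Complex x y))) + (\<Sum>a\<in>Z. real (m a) * ln (cmod (e1 (Complex x y) - e1 a))))
      ((A + B * y) + (\<Sum>a\<in>Z. real (m a) * (- 2 * pi * y + 2 * pi * max 0 (y - Im a))))"
      by (intro has_mean_add has_mean_sum has_mean_cmult has_mean_ln_e1_diff AB y)
    also have "(\<Sum>a\<in>Z. real (m a) * (- 2 * pi * y + 2 * pi * max 0 (y - Im a)))
        = (\<Sum>a\<in>Z. real (m a) * (- 2 * pi * y + 2 * pi * max 0 (y - h)))"
      by (intro sum.cong) (auto simp: Z_def circle_zeros_def)
    also have "\<dots> = n * (- 2 * pi * y + 2 * pi * max 0 (y - h))"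
      by (simp add: n_def sum_distrib_right)
    finally have "has_mean (\<lambda>x. ln (cmod (g (Complex x y))) + (\<Sum>a\<in>Z. real (m a) * ln (cmod (e1 (Complex x y) - e1 a))))
      ((A + B * y) + n * (- 2 * pi * y + 2 * pi * max 0 (y - h)))" .
    hence "has_mean (\<lambda>x. ln (cmod (D (Complex x y)))) ((A + B * y) + n * (- 2 * pi * y + 2 * pi * max 0 (y - h)))"
    \<comment> \<open>outside the zeros of \<open>D\<close> the logarithm of the product is the sum of the logarithms\<close>
    proof (rule has_mean_cong_countable[where X = "\<Union>a\<in>Z. range (\<lambda>k::int. Re a + of_int k)"])
      show "countable (\<Union>a\<in>Z. range (\<lambda>k::int. Re a + of_int k))"
        using countable_finite[OF Z] by (intro countable_UN) (auto simp: Z_def)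
      fix x assume x: "x \<notin> (\<Union>a\<in>Z. range (\<lambda>k::int. Re a + of_int k))"
      have str: "Complex x y \<in> strip h \<delta>" using y by (simp add: strip_def)
      have ne: "e1 (Complex x y) - e1 a \<noteq> 0" if "a \<in> Z" for a
      proof
        assume "e1 (Complex x y) - e1 a = 0"
        then obtain k where "Complex x y - a = of_int k" by (auto simp: e1_eq_iff elim: Ints_cases)
        hence "x = Re a + of_int k" by (simp add: complex_eq_iff)
        thus False using x that by auto
      qed
      have "ln (cmod (D (Complex x y))) = ln (cmod (zero_product m Z (Complex x y))) + ln (cmod (g (Complex x y)))"
        unfolding g(4)[OF str] norm_mult using g(3)[OF str] ne Z
        by (subst ln_mult) (auto simp: zero_product_def Z_def)
      also have "ln (cmod (zero_product m Z (Complex x y))) = (\<Sum>a\<in>Z. ln (cmod (e1 (Complex x y) - e1 a) ^ m a))"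
        unfolding zero_product_def prod_norm[symmetric] norm_power using ne Z
        by (intro ln_prod) (auto simp: Z_def)
      also have "\<dots> = (\<Sum>a\<in>Z. real (m a) * ln (cmod (e1 (Complex x y) - e1 a)))"
        using ne by (intro sum.cong ln_realpow) auto
      finally show "ln (cmod (g (Complex x y))) + (\<Sum>a\<in>Z. real (m a) * ln (cmod (e1 (Complex x y) - e1 a)))
          = ln (cmod (D (Complex x y)))" by simp
    qed
    moreover have "(A + B * y) + n * (- 2 * pi * y + 2 * pi * max 0 (y - h))
        = A + (B - 2 * pi * n) * y + 2 * pi * n * max 0 (y - h)" by (simp add: algebra_simps)
    ultimately show ?thesis by (simp only:)
  qed
  show ?thesis
    by (rule that[OF \<delta> Z _ off mean[unfolded n Z_def]]) (use pos in \<open>auto simp: Z_def\<close>)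
qed

section \<open>Functions that are affine up to a kink near each point\<close>

text \<open>If the difference \<open>\<phi>\<close> to the chord were positive somewhere, consider the largest point \<open>z\<close> at which
  it attains its maximum. The local form gives \<open>\<phi> (z + \<eta>) + \<phi> (z - \<eta>) \<ge> 2 \<phi> z\<close>, so \<open>z + \<eta>\<close> is a
  maximum as well, contradicting the choice of \<open>z\<close>.\<close>
lemma kinks_below_chord:
  fixes f :: "real \<Rightarrow> real"
  assumes "a < b" and cont: "continuous_on {a..b} f"
    and kink: "\<And>z. a < z \<Longrightarrow> z < b \<Longrightarrow> \<exists>\<delta>>0. \<exists>A B n. n \<ge> 0 \<and> (\<forall>y. \<bar>y - z\<bar> < \<delta> \<longrightarrow> f y = A + B * y + n * max 0 (y - z))"
    and w: "w \<in> {a..b}"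
  shows "f w \<le> f a + (f b - f a) / (b - a) * (w - a)"
proof (rule ccontr)
  define s where "s = (f b - f a) / (b - a)"
  define \<phi> where "\<phi> = (\<lambda>x. f x - (f a + s * (x - a)))"
  assume "\<not> ?thesis"
  hence pos: "\<phi> w > 0" by (simp add: \<phi>_def s_def)
  have ends: "\<phi> a = 0" "\<phi> b = 0" using \<open>a < b\<close> by (auto simp: \<phi>_def s_def)
  have cont\<phi>: "continuous_on {a..b} \<phi>" unfolding \<phi>_def by (intro continuous_intros cont)
  have "{a..b} \<noteq> {}" using \<open>a < b\<close> by simp
  from continuous_attains_sup[OF compact_Icc this cont\<phi>]
  obtain x0 where x0: "x0 \<in> {a..b}" "\<And>x. x \<in> {a..b} \<Longrightarrow> \<phi> x \<le> \<phi> x0"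
    by blast
  define S where "S = {x \<in> {a..b}. \<phi> x = \<phi> x0}"
  have "closed S"
    unfolding S_def by (rule continuous_closed_preimage_constant[OF cont\<phi> closed_atLeastAtMost])
  moreover have "bounded S" unfolding S_def by (rule bounded_subset[of "{a..b}"]) auto
  ultimately have "compact S" by (simp add: compact_eq_bounded_closed)
  moreover have "S \<noteq> {}" using x0 by (auto simp: S_def)
  ultimately have "\<exists>z\<in>S. \<forall>x\<in>S. x \<le> z" by (rule compact_attains_sup)
  then obtain z where z: "z \<in> S" "\<And>x. x \<in> S \<Longrightarrow> x \<le> z" by blast
  have max: "\<phi> x \<le> \<phi> z" if "x \<in> {a..b}" for x using x0(2)[OF that] z(1) by (simp add: S_def)
  have "\<phi> z > 0" using max[OF w] pos by simp
  hence "z \<noteq> a" "z \<noteq> b" using ends by auto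
  hence zab: "a < z" "z < b" using z(1) by (auto simp: S_def)
  obtain \<delta> A B n where \<delta>: "\<delta> > 0" "n \<ge> 0" "\<And>y. \<bar>y - z\<bar> < \<delta> \<Longrightarrow> f y = A + B * y + n * max 0 (y - z)"
    using kink[OF zab] by blast
  define \<eta> where "\<eta> = min \<delta> (min (z - a) (b - z)) / 2"
  have \<eta>: "\<eta> > 0" "\<eta> < \<delta>" "\<eta> < z - a" "\<eta> < b - z"
    using \<delta>(1) zab unfolding \<eta>_def by (auto simp: min_def)
  have "\<phi> (z + \<eta>) + \<phi> (z - \<eta>) - 2 * \<phi> z = n * \<eta>"
    using \<eta> \<delta>(3)[of "z + \<eta>"] \<delta>(3)[of "z - \<eta>"] \<delta>(3)[of z] by (simp add: \<phi>_def algebra_simps)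
  moreover have "n * \<eta> \<ge> 0" using \<delta>(2) \<eta>(1) by simp
  moreover have "\<phi> (z - \<eta>) \<le> \<phi> z" "\<phi> (z + \<eta>) \<le> \<phi> z" using \<eta> zab by (auto intro!: max)
  ultimately have "\<phi> (z + \<eta>) = \<phi> z" by linarith
  hence "z + \<eta> \<in> S" using z(1) \<eta> by (auto simp: S_def)
  thus False using z(2) \<eta>(1) by fastforce
qed

lemma kinks_continuous_on:
  fixes L :: "real \<Rightarrow> real"
  assumes "\<And>h. h \<in> I \<Longrightarrow> \<exists>\<delta>>0. \<exists>A B. \<forall>y. \<bar>y - h\<bar> < \<delta> \<longrightarrow> L y = A + B * y + n h * max 0 (y - h)"
  shows "continuous_on I L"
proof (intro continuous_at_imp_continuous_on ballI)
  fix h assume "h \<in> I"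
  then obtain \<delta> A B where \<delta>: "\<delta> > 0" "\<And>y. \<bar>y - h\<bar> < \<delta> \<Longrightarrow> L y = A + B * y + n h * max 0 (y - h)"
    using assms by blast
  have "eventually (\<lambda>y. L y = A + B * y + n h * max 0 (y - h)) (nhds h)"
    unfolding eventually_nhds_metric using \<delta> by (intro exI[of _ \<delta>]) (auto simp: dist_real_def)
  moreover have "isCont (\<lambda>y. A + B * y + n h * max 0 (y - h)) h" by (intro continuous_intros)
  ultimately show "isCont L h" by (simp add: isCont_cong)
qed

lemma kinks_convex_on:
  fixes L :: "real \<Rightarrow> real"
  assumes "convex I" and nonneg: "\<And>h. h \<in> I \<Longrightarrow> n h \<ge> 0"
    and kink: "\<And>h. h \<in> I \<Longrightarrow> \<exists>\<delta>>0. \<exists>A B. \<forall>y. \<bar>y - h\<bar> < \<delta> \<longrightarrow> L y = A + B * y + n h * max 0 (y - h)"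
  shows "convex_on I L"
proof (rule convex_on_linorderI)
  fix t x y :: real assume t: "0 < t" "t < 1" and xy: "x \<in> I" "y \<in> I" "x < y"
  have sub: "{x..y} \<subseteq> I"
    using xy \<open>convex I\<close> by (metis atLeastAtMost_iff connected_contains_Icc convex_connected subsetI)
  define w where "w = (1 - t) * x + t * y"
  have wx: "w - x = t * (y - x)" by (simp add: w_def algebra_simps)
  have wy: "y - w = (1 - t) * (y - x)" by (simp add: w_def algebra_simps)
  have w: "w \<in> {x..y}"
    using wx wy t xy by (metis atLeastAtMost_iff diff_ge_0_iff_ge less_imp_le mult_nonneg_nonneg)
  have "L w \<le> L x + (L y - L x) / (y - x) * (w - x)"
  proof (rule kinks_below_chord[OF \<open>x < y\<close> _ _ w])
    show "continuous_on {x..y} L" using kinks_continuous_on[OF kink] sub by (rule continuous_on_subset)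
    fix z assume "x < z" "z < y"
    hence "z \<in> I" using sub by auto
    thus "\<exists>\<delta>>0. \<exists>A B n. n \<ge> 0 \<and> (\<forall>y. \<bar>y - z\<bar> < \<delta> \<longrightarrow> L y = A + B * y + n * max 0 (y - z))"
      using kink[of z] nonneg[of z] by blast
  qed
  also have "\<dots> = (1 - t) * L x + t * L y" unfolding wx using xy by (simp add: field_simps)
  finally show "L ((1 - t) *\<^sub>R x + t *\<^sub>R y) \<le> (1 - t) * L x + t * L y" by (simp add: w_def)
qed fact

text \<open>On an interval without kinks both \<open>L\<close> and \<open>- L\<close> lie below their chords, so \<open>L\<close> is affine there.
  The kinks have no limit point in the set, as around each point there is at most one.\<close>
lemma kinks_piecewise_linear_on:
  fixes L :: "real \<Rightarrow> real"
  assumes kink: "\<And>h. h \<in> I \<Longrightarrow> \<exists>\<delta>>0. \<exists>A B. \<forall>y. \<bar>y - h\<bar> < \<delta> \<longrightarrow>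
      L y = A + B * y + n h * max 0 (y - h) \<and> (y \<noteq> h \<longrightarrow> n y = 0)"
  shows "piecewise_linear_on I L"
  unfolding piecewise_linear_on_def
proof (intro exI[of _ "{h \<in> I. n h \<noteq> 0}"] conjI allI impI)
  fix a b :: real assume ab: "{a..b} \<subseteq> I"
  show "finite ({h \<in> I. n h \<noteq> 0} \<inter> {a..b})" (is "finite ?K")
  proof (rule ccontr)
    assume "infinite ?K"
    then obtain h where h: "h \<in> {a..b}" "h islimpt ?K"
      using compact_Icc[of a b] unfolding compact_eq_Bolzano_Weierstrass by blast
    then obtain \<delta> where \<delta>: "\<delta> > 0" "\<And>y. \<bar>y - h\<bar> < \<delta> \<Longrightarrow> y \<noteq> h \<Longrightarrow> n y = 0"
      using kink[of h] ab by blast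
    obtain y where "y \<in> ?K" "y \<noteq> h" "dist y h < \<delta>"
      using h(2) \<delta>(1) unfolding islimpt_approachable by blast
    thus False using \<delta>(2)[of y] by (simp add: dist_real_def)
  qed
next
  fix a b :: real assume ab: "{a..b} \<subseteq> I \<and> {a<..<b} \<inter> {h \<in> I. n h \<noteq> 0} = {}"
  show "\<exists>m c. \<forall>x\<in>{a..b}. L x = m * x + c"
  proof (cases "a < b")
    case True
    have lin: "\<exists>\<delta>>0. \<exists>A B. \<forall>y. \<bar>y - z\<bar> < \<delta> \<longrightarrow> L y = A + B * y" if "a < z" "z < b" for z
    proof -
      have "z \<in> I" "n z = 0" using that ab by (auto simp: subset_iff)
      thus ?thesis using kink[of z] by auto
    qed
    have cont: "continuous_on {a..b} L"
      using kinks_continuous_on[of I L n] kink ab by (meson continuous_on_subset)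
    define m where "m = (L b - L a) / (b - a)"
    have "L x = L a + m * (x - a)" if x: "x \<in> {a..b}" for x
    proof (rule antisym)
      show "L x \<le> L a + m * (x - a)"
        unfolding m_def
      proof (rule kinks_below_chord[OF True cont _ x])
        fix z assume "a < z" "z < b"
        from lin[OF this] obtain \<delta> A B where "\<delta> > 0" "\<forall>y. \<bar>y - z\<bar> < \<delta> \<longrightarrow> L y = A + B * y" by blast
        hence "\<delta> > 0 \<and> (0::real) \<ge> 0 \<and> (\<forall>y. \<bar>y - z\<bar> < \<delta> \<longrightarrow> L y = A + B * y + 0 * max 0 (y - z))" by simp
        thus "\<exists>\<delta>>0. \<exists>A B n. n \<ge> 0 \<and> (\<forall>y. \<bar>y - z\<bar> < \<delta> \<longrightarrow> L y = A + B * y + n * max 0 (y - z))" by blast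
      qed
      have "- L x \<le> - L a + (- L b - - L a) / (b - a) * (x - a)"
      proof (rule kinks_below_chord[OF True _ _ x])
        show "continuous_on {a..b} (\<lambda>x. - L x)" by (intro continuous_intros cont)
        fix z assume "a < z" "z < b"
        from lin[OF this] obtain \<delta> A B where "\<delta> > 0" "\<forall>y. \<bar>y - z\<bar> < \<delta> \<longrightarrow> L y = A + B * y" by blast
        hence "\<delta> > 0 \<and> (0::real) \<ge> 0 \<and> (\<forall>y. \<bar>y - z\<bar> < \<delta> \<longrightarrow> - L y = (- A) + (- B) * y + 0 * max 0 (y - z))" by simp
        thus "\<exists>\<delta>>0. \<exists>A B n. n \<ge> 0 \<and> (\<forall>y. \<bar>y - z\<bar> < \<delta> \<longrightarrow> - L y = A + B * y + n * max 0 (y - z))" by blast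
      qed
      also have "(- L b - - L a) / (b - a) = - m" by (simp add: m_def minus_divide_left)
      finally show "L a + m * (x - a) \<le> L x" by simp
    qed
    hence "\<forall>x\<in>{a..b}. L x = m * x + (L a - m * a)" by (simp add: algebra_simps)
    thus ?thesis by blast
  next
    case False
    hence "\<forall>x\<in>{a..b}. L x = 0 * x + L a"
      by (auto intro!: arg_cong[of _ _ L])
    thus ?thesis by blast
  qed
qed auto

lemma kink_one_sided_derivatives:
  fixes L :: "real \<Rightarrow> real"
  assumes "\<delta> > 0" and L: "\<And>y. \<bar>y - h\<bar> < \<delta> \<Longrightarrow> L y = A + B * y + n * max 0 (y - h)"
  shows "(L has_real_derivative B) (at_left h)" "(L has_real_derivative B + n) (at_right h)"
proof -
  have "(L has_real_derivative B) (at h within {..h})"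
  proof (rule has_field_derivative_transform_within[OF _ \<open>\<delta> > 0\<close>])
    show "((\<lambda>y. A + B * y) has_real_derivative B) (at h within {..h})"
      by (auto intro!: derivative_eq_intros)
  qed (auto simp: L dist_real_def)
  thus "(L has_real_derivative B) (at_left h)" by (rule DERIV_subset) auto
  have "(L has_real_derivative B + n) (at h within {h..})"
  proof (rule has_field_derivative_transform_within[OF _ \<open>\<delta> > 0\<close>])
    show "((\<lambda>y. A + B * y + n * (y - h)) has_real_derivative B + n) (at h within {h..})"
      by (auto intro!: derivative_eq_intros)
  qed (auto simp: L dist_real_def)
  thus "(L has_real_derivative B + n) (at_right h)" by (rule DERIV_subset) auto
qed

section \<open>Comparing coordinates at different heights\<close>

lemma eventually_nonzero_near_line:
  assumes D: "D holomorphic_on strip h \<epsilon>" and nz: "t0 \<in> strip h \<epsilon>" "D t0 \<noteq> 0"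
    and h': "\<bar>h' - h\<bar> < \<epsilon>" "\<eta> > 0"
  obtains t where "t \<in> strip h' \<eta>" "D t \<noteq> 0"
proof -
  define s where "s = Complex 0 h'"
  have s: "s \<in> strip h \<epsilon>" "s \<in> strip h' \<eta>" using h' by (auto simp: s_def strip_def)
  have "eventually (\<lambda>t. D t \<noteq> 0) (at s)" by (rule eventually_nonzero_strip[OF D nz s(1)])
  moreover have "eventually (\<lambda>t. t \<in> strip h' \<eta>) (at s)"
    using open_strip s(2) by (rule eventually_at_in_open')
  ultimately have "eventually (\<lambda>t. D t \<noteq> 0 \<and> t \<in> strip h' \<eta>) (at s)" by (rule eventually_conj)
  hence "\<exists>t. D t \<noteq> 0 \<and> t \<in> strip h' \<eta>" by (rule eventually_happens'[OF at_neq_bot])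
  thus ?thesis using that by blast
qed

context ring_coords
begin

text \<open>The circle is compact, so the open set \<open>ring_part A \<psi>\<close> contains a strip around it.\<close>
lemma strip_subset_ring_part:
  obtains \<epsilon> where "\<epsilon> > 0" "strip h \<epsilon> \<subseteq> ring_part A \<psi>"
proof -
  define K where "K = cbox (Complex 0 h) (Complex 1 h)"
  have "compact K" unfolding K_def by (rule compact_cbox)
  moreover have "K \<subseteq> ring_part A \<psi>"
    using line_subset_ring_part by (auto simp: K_def in_cbox_complex_iff)
  ultimately obtain e where e: "e > 0" "(\<Union>x\<in>K. ball x e) \<subseteq> ring_part A \<psi>"
    using compact_subset_open_imp_ball_epsilon_subset[OF _ ring_part_open] by metis
  have "strip h e \<subseteq> ring_part A \<psi>"
  proof
    fix t assume t: "t \<in> strip h e"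
    define t' where "t' = t + of_int (- \<lfloor>Re t\<rfloor>)"
    have "0 \<le> Re t' \<and> Re t' \<le> 1" by (simp add: t'_def) linarith
    hence "Complex (Re t') h \<in> K" by (simp add: K_def in_cbox_complex_iff)
    moreover have "dist (Complex (Re t') h) t' = \<bar>Im t - h\<bar>"
      by (simp add: dist_norm cmod_def t'_def abs_minus_commute)
    hence "t' \<in> ball (Complex (Re t') h) e" using t by (simp add: strip_def)
    ultimately have "t' \<in> ring_part A \<psi>" using e(2) by blast
    thus "t \<in> ring_part A \<psi>" unfolding t'_def by (simp only: ring_part_shift)
  qed
  thus ?thesis using that e(1) by blast
qed

lemma coord_deriv_holomorphic_strip:
  assumes f: "rotates G f \<beta>" and S: "strip h \<epsilon> \<subseteq> ring_part A \<psi>"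
  shows "coord_deriv A B \<psi> f \<psi> holomorphic_on strip h \<epsilon>"
proof -
  interpret two_coords h0 h1 \<iota> h A B \<psi> h A B \<psi> by unfold_locales
  have "coord_deriv A B \<psi> f \<psi> field_differentiable at t" if "t \<in> strip h \<epsilon>" for t
    using coord_deriv_field_differentiable[OF f] S that strip_shift(1)[of t \<beta> h \<epsilon>] by blast
  thus ?thesis by (simp add: holomorphic_on_def field_differentiable_at_within)
qed

end

context two_coords
begin

text \<open>The factor \<open>c\<close> by which the transverse coordinates of two systems differ along a common circle is
  holomorphic and has no zeros, and the two transverse derivatives differ by the coboundary
  \<open>c (t + \<alpha>) / c t\<close>. Both facts are the chain rule, applied to the two ways of composing \<open>f\<close> with
  the change of coordinates, and to the change of coordinates there and back.\<close>
lemma transition: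
  assumes f: "X.rotates G f \<alpha>" and S: "strip h \<epsilon> \<subseteq> X.ring_part A \<psi>" "\<bar>h' - h\<bar> < \<epsilon>" and t: "Im t = h'"
  defines "c \<equiv> coord_deriv A' B' \<psi>' (\<lambda>p. p) \<psi>"
  shows transition_cocycle: "coord_deriv A' B' \<psi>' f \<psi>' t * c t = c (t + of_real \<alpha>) * coord_deriv A B \<psi> f \<psi> t"
    and transition_nonzero: "c t \<noteq> 0"
    and transition_field_differentiable: "c field_differentiable at t"
    and transition_periodic: "c (t + 1) = c t"
proof -
  have X: "ring_coords h0 h1 \<iota> h A B \<psi>" and Y: "ring_coords h0 h1 \<iota> h' A' B' \<psi>'" by unfold_locales
  have line: "s \<in> X.ring_part A \<psi>" "s \<in> X.ring_part A' \<psi>'" if "Im s = h'" for s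
    using S that Y.line_subset_ring_part by (auto simp: strip_def)
  note mem = line[OF t] line[of "t + of_real \<alpha>"]
  have 1: "coord_deriv A' B' \<psi>' f \<psi> t = coord_deriv A' B' \<psi>' f \<psi>' t * c t"
    using X.coord_deriv_compose[OF X Y Y X.rotates_id f, of t] mem t by (simp add: c_def)
  have 2: "coord_deriv A' B' \<psi>' f \<psi> t = c (t + of_real \<alpha>) * coord_deriv A B \<psi> f \<psi> t"
    using X.coord_deriv_compose[OF X X Y f X.rotates_id, of t] mem t by (simp add: c_def)
  show "coord_deriv A' B' \<psi>' f \<psi>' t * c t = c (t + of_real \<alpha>) * coord_deriv A B \<psi> f \<psi> t"
    using 1 2 by simp
  have "t \<in> A" using mem(1) by (simp add: X.ring_part_def)
  hence "1 = coord_deriv A B \<psi> (\<lambda>p. p) \<psi>' t * c t"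
    using X.coord_deriv_compose[OF X Y X X.rotates_id X.rotates_id, of t] mem X.coord_deriv_id by (simp add: c_def)
  thus "c t \<noteq> 0" by auto
  show "c field_differentiable at t"
    unfolding c_def using coord_deriv_field_differentiable[OF X.rotates_id] mem by simp
  show "c (t + 1) = c t"
    unfolding c_def using X.coord_deriv_periodic[OF \<open>t \<in> A\<close>, of A' B' \<psi>' "\<lambda>p. p" 1] by simp
qed

lemma coord_deriv_zero_iff:
  assumes f: "X.rotates G f \<alpha>" and S: "strip h \<epsilon> \<subseteq> X.ring_part A \<psi>" "\<bar>h' - h\<bar> < \<epsilon>" and t: "Im t = h'"
  shows "coord_deriv A' B' \<psi>' f \<psi>' t = 0 \<longleftrightarrow> coord_deriv A B \<psi> f \<psi> t = 0"
  using transition(1,2)[OF f S t] transition(2)[OF f S, of "t + of_real \<alpha>"] t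
  by (metis add.right_neutral Im_complex_of_real mult_eq_0_iff plus_complex.sel(2))

text \<open>The logarithm of the coboundary is a difference of a periodic continuous function and its shift by
  \<open>\<alpha>\<close>, so its mean is zero.\<close>
lemma mean_coord_deriv_eq:
  assumes f: "X.rotates G f \<alpha>" and S: "strip h \<epsilon> \<subseteq> X.ring_part A \<psi>" "\<bar>h' - h\<bar> < \<epsilon>"
    and nz: "\<And>t. Im t = h' \<Longrightarrow> coord_deriv A B \<psi> f \<psi> t \<noteq> 0"
    and mean: "has_mean (\<lambda>x. ln (cmod (coord_deriv A B \<psi> f \<psi> (Complex x h')))) m"
  shows "has_mean (\<lambda>x. ln (cmod (coord_deriv A' B' \<psi>' f \<psi>' (Complex x h')))) m"
proof -
  define c where "c = coord_deriv A' B' \<psi>' (\<lambda>p. p) \<psi>"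
  note T = transition[OF f S, folded c_def]
  define k where "k = (\<lambda>x. ln (cmod (c (Complex x h'))))"
  have "continuous_on {0..1} k"
  proof (intro continuous_at_imp_continuous_on ballI)
    fix x :: real
    have "isCont c (Complex x h')" by (rule field_differentiable_imp_continuous_at[OF T(3)]) simp
    moreover have "isCont (\<lambda>x. Complex x h') x" unfolding Complex_eq by (intro continuous_intros)
    ultimately have "isCont (\<lambda>x. c (Complex x h')) x" by (metis isCont_o2)
    thus "isCont k x" unfolding k_def using T(2)[of "Complex x h'"] by (intro continuous_intros) auto
  qed
  hence "set_integrable lborel {0..1} k" by (rule borel_integrable_atLeastAtMost')
  then obtain m0 where m0: "has_mean k m0" by (auto simp: has_mean_iff)
  have "Complex (x + 1) h' = Complex x h' + 1" for x by (simp add: complex_eq_iff)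
  hence "k (x + 1) = k x" for x using T(4)[of "Complex x h'"] by (simp add: k_def)
  from has_mean_shift[OF this m0] have m0': "has_mean (\<lambda>x. k (x + \<alpha>)) m0" .
  have "ln (cmod (coord_deriv A' B' \<psi>' f \<psi>' (Complex x h')))
      = ln (cmod (coord_deriv A B \<psi> f \<psi> (Complex x h'))) + (k (x + \<alpha>) + - 1 * k x)" for x
  proof -
    define t where "t = Complex x h'"
    have t: "Im t = h'" "Im (t + of_real \<alpha>) = h'" by (auto simp: t_def)
    have "coord_deriv A' B' \<psi>' f \<psi>' t = coord_deriv A B \<psi> f \<psi> t * (c (t + of_real \<alpha>) / c t)"
      using T(1,2)[OF t(1)] by (simp add: field_simps)
    hence "ln (cmod (coord_deriv A' B' \<psi>' f \<psi>' t)) =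
        ln (cmod (coord_deriv A B \<psi> f \<psi> t)) + (ln (cmod (c (t + of_real \<alpha>))) - ln (cmod (c t)))"
      using nz[OF t(1)] T(2)[OF t(1)] T(2)[OF t(2)] by (simp add: norm_mult norm_divide ln_mult ln_div)
    moreover have "t + of_real \<alpha> = Complex (x + \<alpha>) h'" by (simp add: t_def complex_eq_iff)
    ultimately show ?thesis by (simp add: k_def t_def)
  qed
  moreover have "has_mean (\<lambda>x. ln (cmod (coord_deriv A B \<psi> f \<psi> (Complex x h'))) + (k (x + \<alpha>) + - 1 * k x)) (m + (m0 + - 1 * m0))"
    by (intro has_mean_add has_mean_cmult mean m0 m0')
  ultimately show ?thesis by simp
qed

end

lemma convex_heights: "convex (heights h0 h1)"
proof -
  have "is_interval (heights h0 h1)"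
    unfolding is_interval_1 heights_def
    by (auto intro: less_le_trans[where y = "ereal a" for a] le_less_trans[where y = "ereal b" for b])
  thus ?thesis by (simp add: is_interval_convex)
qed

text \<open>One coordinate system for each height. The transverse derivative \<open>D h\<close> is computed in the system
  at height \<open>h\<close>, so comparing nearby heights \<open>h\<close> and \<open>y\<close> means comparing \<open>D h\<close> and \<open>D y\<close> on the
  circle of height \<open>y\<close>.\<close>
locale coords_family = annulus +
  fixes A B :: "real \<Rightarrow> complex set" and \<psi> :: "real \<Rightarrow> complex \<Rightarrow> complex \<Rightarrow> cp2"
    and G :: "complex^3 \<Rightarrow> complex^3" and f :: "cp2 \<Rightarrow> cp2" and \<alpha> :: real
  assumes family: "\<And>h. h \<in> heights h0 h1 \<Longrightarrow> adapted_coordinates h0 h1 \<iota> h (A h) (B h) (\<psi> h)"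
    and rot: "rotates G f \<alpha>"
begin

definition D :: "real \<Rightarrow> complex \<Rightarrow> complex"
  where "D h = coord_deriv (A h) (B h) (\<psi> h) f (\<psi> h)"

lemma coords: "h \<in> heights h0 h1 \<Longrightarrow> ring_coords h0 h1 \<iota> h (A h) (B h) (\<psi> h)"
  using family by unfold_locales

lemma coords2: "h \<in> heights h0 h1 \<Longrightarrow> h' \<in> heights h0 h1 \<Longrightarrow>
    two_coords h0 h1 \<iota> h (A h) (B h) (\<psi> h) h' (A h') (B h') (\<psi> h')"
  using coords by (simp add: two_coords_def)

text \<open>Half the width of some strip around the circle of height \<open>h\<close> on which the coordinates at height \<open>h\<close>
  describe the ring.\<close>
definition ring_width :: "real \<Rightarrow> real"
  where "ring_width h = (SOME \<epsilon>. \<epsilon> > 0 \<and> strip h \<epsilon> \<subseteq> ring_part (A h) (\<psi> h))"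

lemma ring_width:
  assumes "h \<in> heights h0 h1"
  shows "ring_width h > 0" "strip h (ring_width h) \<subseteq> ring_part (A h) (\<psi> h)"
proof -
  have "\<exists>\<epsilon>. \<epsilon> > 0 \<and> strip h \<epsilon> \<subseteq> ring_part (A h) (\<psi> h)"
    using ring_coords.strip_subset_ring_part[OF coords[OF assms]] by blast
  from someI_ex[OF this] show "ring_width h > 0" "strip h (ring_width h) \<subseteq> ring_part (A h) (\<psi> h)"
    by (auto simp: ring_width_def)
qed

lemma near_in_heights:
  assumes "h \<in> heights h0 h1" "\<bar>h' - h\<bar> < ring_width h"
  shows "h' \<in> heights h0 h1"
proof -
  have "Complex 0 h' \<in> strip h (ring_width h)" using assms(2) by (simp add: strip_def)
  thus ?thesis using ring_width(2)[OF assms(1)] by (auto simp: ring_part_def cylinder_def)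
qed

lemma D_holomorphic: "h \<in> heights h0 h1 \<Longrightarrow> D h holomorphic_on strip h (ring_width h)"
  unfolding D_def using ring_coords.coord_deriv_holomorphic_strip[OF coords rot ring_width(2)] .

lemma D_periodic:
  assumes "h \<in> heights h0 h1" "t \<in> strip h (ring_width h)"
  shows "D h (t + 1) = D h t"
proof -
  have "t \<in> A h" using ring_width(2)[OF assms(1)] assms(2) by (auto simp: ring_part_def)
  from ring_coords.coord_deriv_periodic[OF coords[OF assms(1)] this, of _ _ _ _ 1]
  show ?thesis by (simp add: D_def)
qed

lemma D_zero_iff:
  assumes "h \<in> heights h0 h1" "\<bar>Im t - h\<bar> < ring_width h"
  shows "D (Im t) t = 0 \<longleftrightarrow> D h t = 0"
  unfolding D_def
  by (rule two_coords.coord_deriv_zero_iff[OF coords2[OF assms(1) near_in_heights[OF assms]] rot ring_width(2)[OF assms(1)] assms(2)]) simp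

text \<open>On a thin strip around height \<open>h'\<close> both \<open>D h\<close> and \<open>D h'\<close> have the same zeros, and by the
  identity theorem either of them vanishes identically if it vanishes on that strip.\<close>
lemma D_nonzero_propagates:
  assumes h: "h \<in> heights h0 h1" and h': "h' \<in> heights h0 h1" "\<bar>h' - h\<bar> < ring_width h"
  shows "(\<exists>t\<in>strip h (ring_width h). D h t \<noteq> 0) \<longleftrightarrow> (\<exists>t\<in>strip h' (ring_width h'). D h' t \<noteq> 0)"
proof -
  define \<eta> where "\<eta> = min (ring_width h - \<bar>h' - h\<bar>) (ring_width h')"
  have \<eta>: "\<eta> > 0" using h' ring_width(1)[OF h'(1)] by (simp add: \<eta>_def)
  have near: "t \<in> strip h (ring_width h) \<and> t \<in> strip h' (ring_width h') \<and> (D h t = 0 \<longleftrightarrow> D h' t = 0)" if "t \<in> strip h' \<eta>" for t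
  proof -
    have "\<bar>Im t - h\<bar> < ring_width h" "\<bar>Im t - h'\<bar> < ring_width h'"
      using that by (auto simp: strip_def \<eta>_def)
    thus ?thesis using D_zero_iff[OF h] D_zero_iff[OF h'(1)] by (auto simp: strip_def)
  qed
  show ?thesis
  proof
    assume "\<exists>t\<in>strip h (ring_width h). D h t \<noteq> 0"
    then obtain t0 where "t0 \<in> strip h (ring_width h)" "D h t0 \<noteq> 0" by blast
    from eventually_nonzero_near_line[OF D_holomorphic[OF h] this h'(2) \<eta>]
    obtain t where "t \<in> strip h' \<eta>" "D h t \<noteq> 0" .
    thus "\<exists>t\<in>strip h' (ring_width h'). D h' t \<noteq> 0" using near by blast
  next
    assume "\<exists>t\<in>strip h' (ring_width h'). D h' t \<noteq> 0"
    then obtain t0 where "t0 \<in> strip h' (ring_width h')" "D h' t0 \<noteq> 0" by blast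
    from eventually_nonzero_near_line[OF D_holomorphic[OF h'(1)] this _ \<eta>, of h'] ring_width(1)[OF h'(1)]
    obtain t where "t \<in> strip h' \<eta>" "D h' t \<noteq> 0" by auto
    thus "\<exists>t\<in>strip h (ring_width h). D h t \<noteq> 0" using near by blast
  qed
qed

text \<open>By the previous lemma the heights at which \<open>D h\<close> vanishes identically form an open and closed set.\<close>
lemma D_nonzero:
  assumes "t \<in> cylinder h0 h1" "D (Im t) t \<noteq> 0" and h: "h \<in> heights h0 h1"
  shows "\<exists>s\<in>strip h (ring_width h). D h s \<noteq> 0"
proof (rule connected_induction_simple[where S = "heights h0 h1" and a = "Im t" and b = h
      and P = "\<lambda>h. \<exists>s\<in>strip h (ring_width h). D h s \<noteq> 0"])
  show "connected (heights h0 h1)" by (rule convex_connected[OF convex_heights])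
  show t: "Im t \<in> heights h0 h1" using assms(1) by (simp add: cylinder_def)
  show "\<exists>s\<in>strip (Im t) (ring_width (Im t)). D (Im t) s \<noteq> 0"
    using assms(2) ring_width(1)[OF t] by (intro bexI[of _ t]) (auto simp: strip_def)
  fix h assume h: "h \<in> heights h0 h1"
  show "\<exists>T. openin (top_of_set (heights h0 h1)) T \<and> h \<in> T \<and>
      (\<forall>x\<in>T. \<forall>y\<in>T. (\<exists>s\<in>strip x (ring_width x). D x s \<noteq> 0) \<longrightarrow> (\<exists>s\<in>strip y (ring_width y). D y s \<noteq> 0))"
  proof (intro exI[of _ "heights h0 h1 \<inter> ball h (ring_width h)"] conjI ballI impI)
    show "openin (top_of_set (heights h0 h1)) (heights h0 h1 \<inter> ball h (ring_width h))"
      by (rule openin_open_Int) simp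
    show "h \<in> heights h0 h1 \<inter> ball h (ring_width h)" using h ring_width(1) by simp
    fix x y assume "x \<in> heights h0 h1 \<inter> ball h (ring_width h)" "y \<in> heights h0 h1 \<inter> ball h (ring_width h)"
      "\<exists>s\<in>strip x (ring_width x). D x s \<noteq> 0"
    thus "\<exists>s\<in>strip y (ring_width y). D y s \<noteq> 0"
      using D_nonzero_propagates[OF h, of x] D_nonzero_propagates[OF h, of y]
      by (auto simp: dist_real_def abs_minus_commute)
  qed
qed fact

definition mult :: "real \<Rightarrow> int"
  where "mult h = (\<Sum>t\<in>circle_zeros (D h) h. zorder (D h) t)"

text \<open>At a height \<open>y \<noteq> h\<close> close to \<open>h\<close> the functions \<open>D h\<close> and \<open>D y\<close> have no zeros and the same
  logarithmic mean, so the local form for the single function \<open>D h\<close> describes all \<open>D y\<close>.\<close>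
lemma lyapunov_local_form:
  assumes t: "t \<in> cylinder h0 h1" "D (Im t) t \<noteq> 0" and h: "h \<in> heights h0 h1"
  obtains \<delta> K M where "\<delta> > 0" "finite (circle_zeros (D h) h)"
    "mult h \<ge> 0" "mult h = 0 \<longleftrightarrow> (\<forall>t. Im t = h \<longrightarrow> D h t \<noteq> 0)"
    "\<And>y. \<bar>y - h\<bar> < \<delta> \<Longrightarrow> y \<in> heights h0 h1"
    "\<And>y. \<bar>y - h\<bar> < \<delta> \<Longrightarrow> y \<noteq> h \<Longrightarrow> (\<forall>t. Im t = y \<longrightarrow> D y t \<noteq> 0)"
    "\<And>y. \<bar>y - h\<bar> < \<delta> \<Longrightarrow> has_mean (\<lambda>x. ln (cmod (D y (Complex x y))))
        (K + M * y + 2 * pi * of_int (mult h) * max 0 (y - h))"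
proof -
  obtain t0 where t0: "t0 \<in> strip h (ring_width h)" "D h t0 \<noteq> 0" using D_nonzero[OF t h] by blast
  obtain \<delta> K M where \<delta>: "0 < \<delta>" "\<delta> \<le> ring_width h" and fin: "finite (circle_zeros (D h) h)"
    and pos: "\<And>a. a \<in> circle_zeros (D h) h \<Longrightarrow> zorder (D h) a > 0"
    and off: "\<And>t. 0 < \<bar>Im t - h\<bar> \<Longrightarrow> \<bar>Im t - h\<bar> < \<delta> \<Longrightarrow> D h t \<noteq> 0"
    and mean: "\<And>y. \<bar>y - h\<bar> < \<delta> \<Longrightarrow> has_mean (\<lambda>x. ln (cmod (D h (Complex x y))))
      (K + M * y + 2 * pi * of_int (\<Sum>a\<in>circle_zeros (D h) h. zorder (D h) a) * max 0 (y - h))"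
    using mean_ln_local_form[OF D_holomorphic[OF h] D_periodic[OF h] ring_width(1)[OF h] t0] by metis
  have heights: "y \<in> heights h0 h1" if "\<bar>y - h\<bar> < \<delta>" for y
    using near_in_heights[OF h, of y] that \<delta> by simp
  show ?thesis
  proof (rule that[OF \<delta>(1) fin])
    show "mult h \<ge> 0" unfolding mult_def using pos by (intro sum_nonneg) (auto intro: less_imp_le)
    have "mult h = 0 \<longleftrightarrow> circle_zeros (D h) h = {}"
      unfolding mult_def using sum_pos[OF fin _ pos] by force
    also have "\<dots> \<longleftrightarrow> (\<forall>t. Im t = h \<longrightarrow> D h t \<noteq> 0)"
    proof
      assume empty: "circle_zeros (D h) h = {}"
      show "\<forall>t. Im t = h \<longrightarrow> D h t \<noteq> 0"
      proof (intro allI impI notI)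
        fix t assume t: "Im t = h" "D h t = 0"
        define t' where "t' = t + of_int (- \<lfloor>Re t\<rfloor>)"
        have "D h t' = 0"
          unfolding t'_def using periodic_of_int[where f = "D h", OF D_periodic[OF h]] t ring_width(1)[OF h] by (simp only: strip_def mem_Collect_eq diff_self abs_zero)
        moreover have "0 \<le> Re t' \<and> Re t' < 1" by (simp add: t'_def) linarith
        ultimately have "t' \<in> circle_zeros (D h) h" using t by (auto simp: circle_zeros_def t'_def)
        thus False using empty by blast
      qed
    qed (auto simp: circle_zeros_def)
    finally show "mult h = 0 \<longleftrightarrow> (\<forall>t. Im t = h \<longrightarrow> D h t \<noteq> 0)" .
    fix y assume y: "\<bar>y - h\<bar> < \<delta>"
    show "y \<in> heights h0 h1" by (rule heights[OF y])
    show "\<forall>t. Im t = y \<longrightarrow> D y t \<noteq> 0" if "y \<noteq> h"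
    proof (intro allI impI)
      fix t assume "Im t = y"
      thus "D y t \<noteq> 0" using D_zero_iff[OF h, of t] off[of t] that y \<delta> by auto
    qed
    show "has_mean (\<lambda>x. ln (cmod (D y (Complex x y)))) (K + M * y + 2 * pi * of_int (mult h) * max 0 (y - h))"
    proof (cases "y = h")
      case True
      thus ?thesis using mean[OF y] by (simp add: mult_def)
    next
      case False
      have "\<bar>y - h\<bar> < ring_width h" using y \<delta> by simp
      from two_coords.mean_coord_deriv_eq[OF coords2[OF h heights[OF y]] rot ring_width(2)[OF h] this]
      show ?thesis using mean[OF y] off False y unfolding D_def[symmetric] mult_def by force
    qed
  qed
qed

end

section \<open>The transverse Lyapunov exponent\<close>

theorem lemma8p5:
  fixes F :: "complex^3 \<Rightarrow> complex^3"
    and H :: "cp2 set"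
    and h0 h1 :: ereal
    and \<iota> :: "complex \<Rightarrow> cp2"
    and \<alpha> :: real
    and A B :: "real \<Rightarrow> complex set"
    and \<psi> :: "real \<Rightarrow> complex \<Rightarrow> complex \<Rightarrow> cp2"
    and D :: "real \<Rightarrow> complex \<Rightarrow> complex"
    and Lyap :: "real \<Rightarrow> real"
  assumes "rational_map F"
    and "herman_ring F H h0 h1 \<iota> \<alpha>"
    and "\<And>h. h \<in> heights h0 h1 \<Longrightarrow> adapted_coordinates h0 h1 \<iota> h (A h) (B h) (\<psi> h)"
  defines "D \<equiv> \<lambda>h. transverse_deriv F (A h) (B h) (\<psi> h)"
    and "Lyap \<equiv> \<lambda>h. horizontal_log_average (D h) (Complex 0 h)"
  assumes "\<exists>t\<in>cylinder h0 h1. D (Im t) t \<noteq> 0"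
  shows "(\<forall>t\<in>cylinder h0 h1.
            set_integrable lborel {0..1} (\<lambda>\<tau>. ln (cmod (D (Im t) (t + of_real \<tau>)))) \<and>
            horizontal_log_average (D (Im t)) t = Lyap (Im t)) \<and>
         convex_on (heights h0 h1) Lyap \<and>
         piecewise_linear_on (heights h0 h1) Lyap \<and>
         (\<forall>h\<in>heights h0 h1. finite (circle_zeros (D h) h) \<and>
           (\<exists>l r. (Lyap has_real_derivative l) (at_left h) \<and>
                  (Lyap has_real_derivative r) (at_right h) \<and>
                  (l \<noteq> r \<longleftrightarrow> (\<exists>t. Im t = h \<and> D h t = 0)) \<and>
                  r - l = 2 * pi * of_int (\<Sum>t\<in>circle_zeros (D h) h. zorder (D h) t)))"
proof -
  interpret annulus h0 h1 \<iota> using assms(2) by unfold_locales (simp add: herman_ring_def)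
  interpret C: coords_family h0 h1 \<iota> A B \<psi> F "rat_map F" \<alpha>
    using assms(3) rotates_rat_map[OF assms(1,2)] by unfold_locales
  have D_eq: "D = C.D"
    by (simp add: fun_eq_iff D_def C.D_def transverse_deriv_eq_coord_deriv)
  obtain t0 where t0: "t0 \<in> cylinder h0 h1" "C.D (Im t0) t0 \<noteq> 0" using assms(6) by (auto simp: D_eq)
  define I where "I = heights h0 h1"
  have Complex_shift: "Complex x y + of_real \<tau> = Complex (\<tau> + x) y" for x y \<tau>
    by (simp add: complex_eq_iff)
  have Lyap: "Lyap y = m" if "has_mean (\<lambda>x. ln (cmod (D y (Complex x y)))) m" for y m
    using that by (simp add: has_mean_iff Lyap_def horizontal_log_average_def Complex_shift)
  have local: "\<exists>\<delta>>0. \<exists>K M. \<forall>y. \<bar>y - h\<bar> < \<delta> \<longrightarrow>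
      Lyap y = K + M * y + 2 * pi * of_int (C.mult h) * max 0 (y - h) \<and> (y \<noteq> h \<longrightarrow> 2 * pi * of_int (C.mult y) = (0 :: real))"
    if h: "h \<in> I" for h
  proof -
    obtain \<delta> K M where \<delta>: "\<delta> > 0"
        "\<And>y. \<bar>y - h\<bar> < \<delta> \<Longrightarrow> y \<in> heights h0 h1"
        "\<And>y. \<bar>y - h\<bar> < \<delta> \<Longrightarrow> y \<noteq> h \<Longrightarrow> (\<forall>t. Im t = y \<longrightarrow> C.D y t \<noteq> 0)"
        "\<And>y. \<bar>y - h\<bar> < \<delta> \<Longrightarrow> has_mean (\<lambda>x. ln (cmod (C.D y (Complex x y))))
        (K + M * y + 2 * pi * of_int (C.mult h) * max 0 (y - h))"
      using C.lyapunov_local_form[OF t0, of h] h unfolding I_def by metis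
    have "C.mult y = 0" if "\<bar>y - h\<bar> < \<delta>" "y \<noteq> h" for y
      using C.lyapunov_local_form[OF t0 \<delta>(2)[OF that(1)]] \<delta>(3)[OF that] by metis
    hence "\<forall>y. \<bar>y - h\<bar> < \<delta> \<longrightarrow>
      Lyap y = K + M * y + 2 * pi * of_int (C.mult h) * max 0 (y - h) \<and> (y \<noteq> h \<longrightarrow> 2 * pi * of_int (C.mult y) = (0 :: real))"
      using Lyap[OF \<delta>(4)[folded D_eq]] by simp
    thus ?thesis using \<delta>(1) by blast
  qed
  show ?thesis
  proof (intro conjI ballI)
    fix t assume "t \<in> cylinder h0 h1"
    hence h: "Im t \<in> heights h0 h1" by (simp add: cylinder_def)
    obtain \<delta> K M where "\<delta> > 0" "\<And>y. \<bar>y - Im t\<bar> < \<delta> \<Longrightarrow> has_mean (\<lambda>x. ln (cmod (C.D y (Complex x y))))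
        (K + M * y + 2 * pi * of_int (C.mult (Im t)) * max 0 (y - Im t))"
      using C.lyapunov_local_form[OF t0 h] by metis
    from this(2)[of "Im t"] this(1)
    obtain m where m: "has_mean (\<lambda>x. ln (cmod (D (Im t) (Complex x (Im t))))) m"
      unfolding D_eq by auto
    have "D (Im t) (Complex (x + 1) (Im t)) = D (Im t) (Complex x (Im t))" for x
      using C.D_periodic[OF h, of "Complex x (Im t)"] C.ring_width(1)[OF h]
      by (simp add: D_eq strip_def Complex_eq algebra_simps)
    hence "ln (cmod (D (Im t) (Complex (x + 1) (Im t)))) = ln (cmod (D (Im t) (Complex x (Im t))))" for x
      by simp
    from has_mean_shift[where f = "\<lambda>x. ln (cmod (D (Im t) (Complex x (Im t))))", OF this m, of "Re t"]
    have "has_mean (\<lambda>\<tau>. ln (cmod (D (Im t) (t + of_real \<tau>)))) m"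
      using Complex_shift[of "Re t" "Im t"] by simp
    thus "set_integrable lborel {0..1} (\<lambda>\<tau>. ln (cmod (D (Im t) (t + of_real \<tau>))))"
      "horizontal_log_average (D (Im t)) t = Lyap (Im t)"
      using Lyap[OF m] by (auto simp: has_mean_iff horizontal_log_average_def)
  next
    have nonneg: "2 * pi * real_of_int (C.mult h) \<ge> 0" if "h \<in> I" for h
    proof -
      have "C.mult h \<ge> 0"
        by (rule C.lyapunov_local_form[OF t0, of h]) (use that in \<open>simp_all add: I_def\<close>)
      thus ?thesis by simp
    qed
    have "convex I" unfolding I_def by (rule convex_heights)
    thus "convex_on (heights h0 h1) Lyap"
      unfolding I_def[symmetric]
    proof (rule kinks_convex_on[where n = "\<lambda>h. 2 * pi * of_int (C.mult h)", OF _ nonneg])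
      fix h assume "h \<in> I"
      from local[OF this] show "\<exists>\<delta>>0. \<exists>K M. \<forall>y. \<bar>y - h\<bar> < \<delta> \<longrightarrow>
        Lyap y = K + M * y + 2 * pi * of_int (C.mult h) * max 0 (y - h)" by blast
    qed
    show "piecewise_linear_on (heights h0 h1) Lyap"
      unfolding I_def[symmetric]
      by (rule kinks_piecewise_linear_on[where n = "\<lambda>h. 2 * pi * of_int (C.mult h)", OF local])
  next
    fix h assume h: "h \<in> heights h0 h1"
    have fin: "finite (circle_zeros (C.D h) h)" and mult: "C.mult h = 0 \<longleftrightarrow> (\<forall>t. Im t = h \<longrightarrow> C.D h t \<noteq> 0)"
      by (rule C.lyapunov_local_form[OF t0 h]; assumption)+
    show "finite (circle_zeros (D h) h)" using fin by (simp add: D_eq)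
    obtain \<delta> K M where \<delta>: "\<delta> > 0" "\<And>y. \<bar>y - h\<bar> < \<delta> \<Longrightarrow>
        Lyap y = K + M * y + 2 * pi * of_int (C.mult h) * max 0 (y - h)"
      using local[of h] h unfolding I_def by blast
    from kink_one_sided_derivatives[OF \<delta>]
    have "(Lyap has_real_derivative M) (at_left h) \<and>
          (Lyap has_real_derivative M + 2 * pi * of_int (C.mult h)) (at_right h) \<and>
          (M \<noteq> M + 2 * pi * of_int (C.mult h) \<longleftrightarrow> (\<exists>t. Im t = h \<and> D h t = 0)) \<and>
          (M + 2 * pi * of_int (C.mult h)) - M = 2 * pi * of_int (\<Sum>t\<in>circle_zeros (D h) h. zorder (D h) t)"
      using mult by (auto simp: D_eq simp flip: C.mult_def)
    thus "\<exists>l r. (Lyap has_real_derivative l) (at_left h) \<and>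
                  (Lyap has_real_derivative r) (at_right h) \<and>
                  (l \<noteq> r \<longleftrightarrow> (\<exists>t. Im t = h \<and> D h t = 0)) \<and>
                  r - l = 2 * pi * of_int (\<Sum>t\<in>circle_zeros (D h) h. zorder (D h) t)"
      by blast
  qed
qed

end
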